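(* Let $\Omega\subset\mathbb C$ be a domain and let $h\in\mathscr W^{1,2}(\Omega)$ be complex valued with Hopf product $\mathcal H=h_\xi\,\overline{h_{\bar\xi}}=0$ almost everywhere in $\Omega$. Then no inner variation of $h$ decreases its energy: for every $\mathscr C^\infty$-diffeomorphism $\xi:\Omega\to\Omega$ of $\Omega$ onto itself with positive Jacobian, the mapping $H(z)=h(\xi(z))$ satisfies $\mathscr E[h]\leqslant\mathscr E[H]$.
   Context: $h_\xi=\frac12(\partial_x-i\partial_y)h$, $h_{\bar\xi}=\frac12(\partial_x+i\partial_y)h$; $\mathscr E[h]=\int_\Omega(|h_\xi|^2+|h_{\bar\xi}|^2)\,\mathbf{d}\xi\in[0,\infty]$ is the Dirichlet energy, $\mathbf{d}\xi$ being the area element. The Jacobian of $\xi=\xi(z)$ is $J_\xi=|\xi_z|^2-|\xi_{\bar z}|^2$. *)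

theory Defs
  imports "HOL-Analysis.Analysis"
begin

text \<open>\<open>C_on k S f\<close>: on the open set \<open>S\<close>, the function \<open>f\<close> is of class \<open>C^k\<close> in the
  real sense. The condition ranges over all directions \<open>v\<close>, hence over all iterated
  directional derivatives of order at most \<open>k\<close>.\<close>

primrec C_on :: "nat \<Rightarrow> 'a::real_normed_vector set \<Rightarrow> ('a \<Rightarrow> 'b::real_normed_vector) \<Rightarrow> bool"
  where
    "C_on 0 S f \<longleftrightarrow> continuous_on S f"
  | "C_on (Suc k) S f \<longleftrightarrow>
       (\<forall>x\<in>S. f differentiable (at x)) \<and>
       (\<forall>v. C_on k S (\<lambda>x. frechet_derivative f (at x) v))"

definition smooth_on :: "'a::real_normed_vector set \<Rightarrow> ('a \<Rightarrow> 'b::real_normed_vector) \<Rightarrow> bool"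
  where "smooth_on S f \<longleftrightarrow> (\<forall>k. C_on k S f)"

definition self_diffeomorphism :: "complex set \<Rightarrow> (complex \<Rightarrow> complex) \<Rightarrow> bool"
  where "self_diffeomorphism \<Omega> \<xi> \<longleftrightarrow>
    bij_betw \<xi> \<Omega> \<Omega> \<and> smooth_on \<Omega> \<xi> \<and> smooth_on \<Omega> (inv_into \<Omega> \<xi>)"

text \<open>Wirtinger derivatives of a function that is differentiable in the real sense: the partial
  derivatives in \<open>x\<close> and \<open>y\<close> are the directional derivatives along \<open>1\<close> and \<open>\<i>\<close>.\<close>

definition wirtinger_z :: "(complex \<Rightarrow> complex) \<Rightarrow> complex \<Rightarrow> complex"
  where "wirtinger_z f z =
    (frechet_derivative f (at z) 1 - \<i> * frechet_derivative f (at z) \<i>) / 2"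

definition wirtinger_zbar :: "(complex \<Rightarrow> complex) \<Rightarrow> complex \<Rightarrow> complex"
  where "wirtinger_zbar f z =
    (frechet_derivative f (at z) 1 + \<i> * frechet_derivative f (at z) \<i>) / 2"

definition wirtinger_jacobian :: "(complex \<Rightarrow> complex) \<Rightarrow> complex \<Rightarrow> real"
  where "wirtinger_jacobian f z = (norm (wirtinger_z f z))\<^sup>2 - (norm (wirtinger_zbar f z))\<^sup>2"

definition test_function :: "complex set \<Rightarrow> (complex \<Rightarrow> real) \<Rightarrow> bool"
  where "test_function \<Omega> \<phi> \<longleftrightarrow>
    smooth_on UNIV \<phi> \<and> compact (closure {z. \<phi> z \<noteq> 0}) \<and> closure {z. \<phi> z \<noteq> 0} \<subseteq> \<Omega>"

definition locally_integrable :: "complex set \<Rightarrow> (complex \<Rightarrow> complex) \<Rightarrow> bool"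
  where "locally_integrable \<Omega> f \<longleftrightarrow>
    (\<forall>K. compact K \<and> K \<subseteq> \<Omega> \<longrightarrow> f absolutely_integrable_on K)"

text \<open>\<open>g\<close> is a weak derivative of \<open>f\<close> on \<open>\<Omega>\<close> in the direction \<open>v\<close>. Only the values of \<open>f\<close> and
  \<open>g\<close> on \<open>\<Omega>\<close> matter.\<close>

definition is_weak_derivative ::
    "complex set \<Rightarrow> complex \<Rightarrow> (complex \<Rightarrow> complex) \<Rightarrow> (complex \<Rightarrow> complex) \<Rightarrow> bool"
  where "is_weak_derivative \<Omega> v f g \<longleftrightarrow>
    locally_integrable \<Omega> f \<and> locally_integrable \<Omega> g \<and>
    (\<forall>\<phi>. test_function \<Omega> \<phi> \<longrightarrow>
      (LINT z:\<Omega>|lebesgue. frechet_derivative \<phi> (at z) v *\<^sub>R f z) =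
      - (LINT z:\<Omega>|lebesgue. \<phi> z *\<^sub>R g z))"

text \<open>A representative of the weak derivative, which is unique up to a null set whenever it
  exists. For a function without a weak derivative the value is unspecified; in particular no
  convention is made about the energy of such a function.\<close>

definition weak_derivative ::
    "complex set \<Rightarrow> complex \<Rightarrow> (complex \<Rightarrow> complex) \<Rightarrow> complex \<Rightarrow> complex"
  where "weak_derivative \<Omega> v f = (SOME g. is_weak_derivative \<Omega> v f g)"

definition weak_z :: "complex set \<Rightarrow> (complex \<Rightarrow> complex) \<Rightarrow> complex \<Rightarrow> complex"
  where "weak_z \<Omega> f z = (weak_derivative \<Omega> 1 f z - \<i> * weak_derivative \<Omega> \<i> f z) / 2"

definition weak_zbar :: "complex set \<Rightarrow> (complex \<Rightarrow> complex) \<Rightarrow> complex \<Rightarrow> complex"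
  where "weak_zbar \<Omega> f z = (weak_derivative \<Omega> 1 f z + \<i> * weak_derivative \<Omega> \<i> f z) / 2"

definition square_integrable :: "complex set \<Rightarrow> (complex \<Rightarrow> complex) \<Rightarrow> bool"
  where "square_integrable \<Omega> f \<longleftrightarrow>
    set_borel_measurable lebesgue \<Omega> f \<and> set_integrable lebesgue \<Omega> (\<lambda>z. (norm (f z))\<^sup>2)"

definition sobolev_W12 :: "complex set \<Rightarrow> (complex \<Rightarrow> complex) set"
  where "sobolev_W12 \<Omega> = {f. square_integrable \<Omega> f \<and>
    (\<exists>g. is_weak_derivative \<Omega> 1 f g \<and> square_integrable \<Omega> g) \<and>
    (\<exists>g. is_weak_derivative \<Omega> \<i> f g \<and> square_integrable \<Omega> g)}"

definition hopf_product :: "complex set \<Rightarrow> (complex \<Rightarrow> complex) \<Rightarrow> complex \<Rightarrow> complex"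
  where "hopf_product \<Omega> f z = weak_z \<Omega> f z * cnj (weak_zbar \<Omega> f z)"

definition dirichlet_energy :: "complex set \<Rightarrow> (complex \<Rightarrow> complex) \<Rightarrow> ennreal"
  where "dirichlet_energy \<Omega> f =
    (\<integral>\<^sup>+z\<in>\<Omega>. ennreal ((norm (weak_z \<Omega> f z))\<^sup>2 + (norm (weak_zbar \<Omega> f z))\<^sup>2) \<partial>lebesgue)"

end

theory Submission
  imports Defs
begin

text \<open>
  Let \<open>(a, b)\<close> be the weak gradient of \<open>h\<close>. By the chain rule \<open>H = h \<circ> \<xi>\<close> has weak partial
  derivatives \<open>D\<xi>(z)v \<bullet> (a, b)(\<xi> z)\<close>. Where the Hopf product vanishes, \<open>b = \<plusminus>\<i>a\<close>, so the energy
  density of \<open>H\<close> is that of \<open>h\<close> at \<open>\<xi> z\<close> times half the squared Hilbert-Schmidt norm of \<open>D\<xi>\<close>,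
  hence at least the latter density times the Jacobian; a change of variables concludes.

  The weak chain rule needs no mollification. With \<open>\<eta> = \<xi>\<inverse>\<close>, substituting \<open>z = \<eta> w\<close> in
  \<open>\<integral> \<partial>\<^sub>v\<phi> \<cdot> H\<close> turns \<open>\<partial>\<^sub>v\<phi>\<close> into the divergence of \<open>(\<phi> \<circ> \<eta>) \<cdot> c\<close>, where \<open>c\<close> is a vector field
  of cofactors of \<open>D\<eta>\<close>, divergence free by the symmetry of mixed partial derivatives. The
  components of \<open>(\<phi> \<circ> \<eta>) \<cdot> c\<close> are test functions, to which the weak derivatives of \<open>h\<close> apply.
\<close>

subsection \<open>Functions of class \<open>C^k\<close>\<close>

text \<open>Each derivative is taken at a point of the open set \<open>S\<close> and depends only on
  the values near that point, so agreement on \<open>S\<close> carries over to derivatives of every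
  order.\<close>

lemma C_on_cong:
  assumes "open S" "\<And>x. x \<in> S \<Longrightarrow> f x = g x" "C_on k S f"
  shows "C_on k S g"
  using assms(2,3)
proof (induction k arbitrary: f g)
  case 0
  then show ?case
    using continuous_on_cong by fastforce
next
  case (Suc k)
  have der: "(g has_derivative frechet_derivative f (at x)) (at x)" if "x \<in> S" for x
    using Suc.prems that assms(1)
    by (auto intro: has_derivative_transform_within_open[of f] simp: frechet_derivative_works)
  have eq: "frechet_derivative f (at x) = frechet_derivative g (at x)" if "x \<in> S" for x
    using der[OF that] frechet_derivative_at by blast
  have "C_on k S (\<lambda>x. frechet_derivative g (at x) v)" for v
    by (rule Suc.IH[of "\<lambda>x. frechet_derivative f (at x) v"]) (use eq Suc.prems in auto)
  then show ?case
    using der by (auto simp: differentiable_def)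
qed

text \<open>Differentiability is tested pointwise, so only continuity has to be glued, and two open
  sets allow that. This serves to extend compactly supported functions by zero.\<close>

lemma C_on_Un:
  assumes "open S" "open T" "C_on k S f" "C_on k T f"
  shows "C_on k (S \<union> T) f"
  using assms(3,4) by (induction k arbitrary: f) (auto intro: continuous_on_open_Un assms)

lemma C_on_imp_continuous_on: "C_on k S f \<Longrightarrow> continuous_on S f"
  by (cases k)
     (auto intro!: continuous_at_imp_continuous_on differentiable_imp_continuous_within)

lemma C_on_Suc_imp_C_on: "C_on (Suc k) S f \<Longrightarrow> C_on k S f"
proof (induction k arbitrary: f)
  case 0
  then show ?case using C_on_imp_continuous_on by (metis C_on.simps(1))
qed (metis C_on.simps(2))

lemma C_on_SucI:
  assumes "open S" "\<And>x. x \<in> S \<Longrightarrow> (f has_derivative f' x) (at x)"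
    and "\<And>v. C_on k S (\<lambda>x. f' x v)"
  shows "C_on (Suc k) S f"
proof -
  have "f' x = frechet_derivative f (at x)" if "x \<in> S" for x
    using assms(2)[OF that] frechet_derivative_at by blast
  then have "C_on k S (\<lambda>x. frechet_derivative f (at x) v)" for v
    using C_on_cong[OF assms(1) _ assms(3)[of v]] by simp
  then show ?thesis
    using assms(2) by (auto simp: differentiable_def)
qed

lemma C_on_Suc_has_derivative:
  "C_on (Suc k) S f \<Longrightarrow> x \<in> S \<Longrightarrow> (f has_derivative frechet_derivative f (at x)) (at x)"
  by (simp add: frechet_derivative_works)

lemma C_on_const: "C_on k S (\<lambda>_. c)"
  by (induction k arbitrary: c) auto

lemma C_on_bounded_linear_compose:
  assumes "bounded_linear L" "open S" "C_on k S f"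
  shows "C_on k S (\<lambda>x. L (f x))"
  using assms(3)
proof (induction k arbitrary: f)
  case 0
  then show ?case
    using bounded_linear.continuous_on[OF assms(1)] by simp
next
  case (Suc k)
  show ?case
  proof (rule C_on_SucI[OF assms(2)])
    show "((\<lambda>x. L (f x)) has_derivative (\<lambda>v. L (frechet_derivative f (at x) v))) (at x)"
      if "x \<in> S" for x
      using bounded_linear.has_derivative[OF assms(1) C_on_Suc_has_derivative[OF Suc.prems that]] .
    show "C_on k S (\<lambda>x. L (frechet_derivative f (at x) v))" for v
      using Suc by simp
  qed
qed

lemma C_on_bounded_linear: "bounded_linear L \<Longrightarrow> C_on k UNIV L"
proof (cases k)
  case (Suc j)
  assume L: "bounded_linear L"
  show ?thesis
    unfolding Suc
    by (rule C_on_SucI[where f' = "\<lambda>_. L"])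
       (auto intro: C_on_const bounded_linear_imp_has_derivative L)
qed (auto intro: linear_continuous_on)

lemma C_on_add:
  assumes "open S" "C_on k S f" "C_on k S g"
  shows "C_on k S (\<lambda>x. f x + g x)"
  using assms(2,3)
proof (induction k arbitrary: f g)
  case 0
  then show ?case by (auto intro: continuous_on_add)
next
  case (Suc k)
  show ?case
  proof (rule C_on_SucI[OF assms(1)])
    show "((\<lambda>x. f x + g x) has_derivative
        (\<lambda>v. frechet_derivative f (at x) v + frechet_derivative g (at x) v)) (at x)"
      if "x \<in> S" for x
      using that Suc.prems by (intro has_derivative_add C_on_Suc_has_derivative)
  qed (use Suc in auto)
qed

lemma C_on_sum:
  assumes "open S" "\<And>i. i \<in> I \<Longrightarrow> C_on k S (f i)"
  shows "C_on k S (\<lambda>x. \<Sum>i\<in>I. f i x)"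
proof (cases "finite I")
  case True
  then show ?thesis
    using assms(2) by (induction I) (auto intro: C_on_const C_on_add assms(1))
qed (auto intro: C_on_const)

lemma C_on_bounded_bilinear:
  assumes "bounded_bilinear B" "open S" "C_on k S f" "C_on k S g"
  shows "C_on k S (\<lambda>x. B (f x) (g x))"
  using assms(3,4)
proof (induction k arbitrary: f g)
  case 0
  then show ?case by (auto intro: bounded_bilinear.continuous_on[OF assms(1)])
next
  case (Suc k)
  show ?case
  proof (rule C_on_SucI[OF assms(2)])
    show "((\<lambda>x. B (f x) (g x)) has_derivative
        (\<lambda>v. B (f x) (frechet_derivative g (at x) v) + B (frechet_derivative f (at x) v) (g x))) (at x)"
      if "x \<in> S" for x
      using that Suc.prems by (intro bounded_bilinear.FDERIV[OF assms(1)] C_on_Suc_has_derivative)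
    show "C_on k S (\<lambda>x. B (f x) (frechet_derivative g (at x) v) + B (frechet_derivative f (at x) v) (g x))"
      for v
      using Suc.prems Suc.prems[THEN C_on_Suc_imp_C_on] by (intro C_on_add assms(2) Suc.IH) auto
  qed
qed

lemmas C_on_mult = C_on_bounded_bilinear[OF bounded_bilinear_mult]
lemmas C_on_scaleR = C_on_bounded_bilinear[OF bounded_bilinear_scaleR]

text \<open>In the chain rule the direction fed to the outer derivative varies with the point,
  whereas \<open>C_on\<close> speaks of fixed directions. Expanding that direction in
  \<open>Basis\<close> gives a finite sum of products to which the induction hypothesis applies;
  this is why the middle space is Euclidean.\<close>

lemma C_on_compose:
  fixes g :: "'a::real_normed_vector \<Rightarrow> 'c::euclidean_space"
    and f :: "'c \<Rightarrow> 'b::real_normed_vector"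
  assumes "open S" "g ` S \<subseteq> T" "C_on k S g" "C_on k T f"
  shows "C_on k S (\<lambda>x. f (g x))"
  using assms(3,4)
proof (induction k arbitrary: f)
  case 0
  then show ?case using continuous_on_compose2 assms(2) by (metis C_on.simps(1))
next
  case (Suc k)
  let ?f' = "\<lambda>x. frechet_derivative f (at x)" and ?g' = "\<lambda>x. frechet_derivative g (at x)"
  show ?case
  proof (rule C_on_SucI[OF assms(1)])
    show "((\<lambda>x. f (g x)) has_derivative (\<lambda>v. \<Sum>b\<in>Basis. (?g' x v \<bullet> b) *\<^sub>R ?f' (g x) b)) (at x)"
      if "x \<in> S" for x
    proof -
      have f': "(f has_derivative ?f' (g x)) (at (g x))"
        using Suc.prems that assms(2) by (intro C_on_Suc_has_derivative) auto
      have der: "((\<lambda>x. f (g x)) has_derivative (\<lambda>v. ?f' (g x) (?g' x v))) (at x)"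
        using has_derivative_compose[OF C_on_Suc_has_derivative[OF Suc.prems(1) that] f'] .
      have rep: "?f' (g x) w = (\<Sum>b\<in>Basis. (w \<bullet> b) *\<^sub>R ?f' (g x) b)" for w
      proof -
        have lin: "linear (?f' (g x))"
          using f' has_derivative_linear by blast
        have "?f' (g x) w = ?f' (g x) (\<Sum>b\<in>Basis. (w \<bullet> b) *\<^sub>R b)"
          by (simp only: euclidean_representation)
        then show ?thesis
          by (simp only: linear_sum[OF lin] linear_cmul[OF lin])
      qed
      show ?thesis
        using der by (rule has_derivative_eq_rhs) (rule ext, rule rep)
    qed
    show "C_on k S (\<lambda>x. \<Sum>b\<in>Basis. (?g' x v \<bullet> b) *\<^sub>R ?f' (g x) b)" for v
    proof (intro C_on_sum C_on_scaleR assms(1))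
      fix b :: 'c
      show "C_on k S (\<lambda>x. ?g' x v \<bullet> b)"
        using Suc.prems by (intro C_on_bounded_linear_compose[OF bounded_linear_inner_left] assms(1)) auto
      show "C_on k S (\<lambda>x. ?f' (g x) b)"
        using Suc.prems C_on_Suc_imp_C_on[OF Suc.prems(1)] by (intro Suc.IH) auto
    qed
  qed
qed

subsection \<open>Symmetry of mixed partial derivatives\<close>

text \<open>The second difference is an increment of \<open>F\<close> along \<open>u\<close>, where
  \<open>F\<close> is itself a difference along \<open>v\<close>. The mean value theorem is applied
  first to \<open>F\<close> and then to the resulting increment of the first derivative.\<close>

lemma second_difference_mean_value:
  fixes f :: "'a::real_normed_vector \<Rightarrow> real"
  assumes "C_on 2 S f" and "s > 0"
    and sub: "\<And>p q. 0 \<le> p \<Longrightarrow> p \<le> s \<Longrightarrow> 0 \<le> q \<Longrightarrow> q \<le> s \<Longrightarrow> x + p *\<^sub>R u + q *\<^sub>R v \<in> S"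
  obtains p q where "0 < p" "p < s" "0 < q" "q < s"
    "f (x + s *\<^sub>R u + s *\<^sub>R v) - f (x + s *\<^sub>R u) - f (x + s *\<^sub>R v) + f x =
      s\<^sup>2 * frechet_derivative (\<lambda>y. frechet_derivative f (at y) u) (at (x + p *\<^sub>R u + q *\<^sub>R v)) v"
proof -
  let ?f1 = "\<lambda>y. frechet_derivative f (at y)"
  let ?f2 = "\<lambda>y. frechet_derivative (\<lambda>y. ?f1 y u) (at y)"
  have d1: "(f has_derivative ?f1 y) (at y)" and d2: "((\<lambda>y. ?f1 y u) has_derivative ?f2 y) (at y)"
    if "y \<in> S" for y
    using assms(1) that by (auto simp: numeral_2_eq_2 frechet_derivative_works[symmetric])
  have lin1: "?f1 y (r *\<^sub>R w) = r * ?f1 y w" and lin2: "?f2 y (r *\<^sub>R w) = r * ?f2 y w"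
    if "y \<in> S" for y r w
    using linear_cmul[OF has_derivative_linear[OF d1[OF that]]]
      linear_cmul[OF has_derivative_linear[OF d2[OF that]]] by auto
  define F where "F \<equiv> \<lambda>p. f (x + p *\<^sub>R u + s *\<^sub>R v) - f (x + p *\<^sub>R u)"
  have "\<exists>p. 0 < p \<and> p < s \<and> F s - F 0 = (s - 0) * (?f1 (x + p *\<^sub>R u + s *\<^sub>R v) u - ?f1 (x + p *\<^sub>R u) u)"
  proof (rule MVT2[OF \<open>s > 0\<close>])
    fix p assume p: "0 \<le> p" "p \<le> s"
    have S: "x + p *\<^sub>R u + s *\<^sub>R v \<in> S" "x + p *\<^sub>R u \<in> S"
      using sub[of p s] sub[of p 0] p \<open>s > 0\<close> by auto
    have "(F has_derivative (\<lambda>r. ?f1 (x + p *\<^sub>R u + s *\<^sub>R v) (r *\<^sub>R u) - ?f1 (x + p *\<^sub>R u) (r *\<^sub>R u))) (at p)"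
      unfolding F_def
      by (rule has_derivative_diff;
          rule has_derivative_compose[where f = "\<lambda>p. x + p *\<^sub>R u + s *\<^sub>R v" and g = f, OF _ d1[OF S(1)]]
               has_derivative_compose[where f = "\<lambda>p. x + p *\<^sub>R u" and g = f, OF _ d1[OF S(2)]];
          auto intro!: derivative_eq_intros)
    then show "DERIV F p :> ?f1 (x + p *\<^sub>R u + s *\<^sub>R v) u - ?f1 (x + p *\<^sub>R u) u"
      unfolding has_field_derivative_def
      by (rule has_derivative_eq_rhs) (use S in \<open>simp add: fun_eq_iff lin1 algebra_simps\<close>)
  qed
  then obtain p where p: "0 < p" "p < s"
    "F s - F 0 = s * (?f1 (x + p *\<^sub>R u + s *\<^sub>R v) u - ?f1 (x + p *\<^sub>R u) u)"
    unfolding diff_zero by blast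
  define G where "G \<equiv> \<lambda>q. ?f1 (x + p *\<^sub>R u + q *\<^sub>R v) u"
  have "\<exists>q. 0 < q \<and> q < s \<and> G s - G 0 = (s - 0) * ?f2 (x + p *\<^sub>R u + q *\<^sub>R v) v"
  proof (rule MVT2[OF \<open>s > 0\<close>])
    fix q assume q: "0 \<le> q" "q \<le> s"
    have S: "x + p *\<^sub>R u + q *\<^sub>R v \<in> S"
      using sub[of p q] p q by auto
    have "(G has_derivative (\<lambda>r. ?f2 (x + p *\<^sub>R u + q *\<^sub>R v) (r *\<^sub>R v))) (at q)"
      unfolding G_def
      by (rule has_derivative_compose[where f = "\<lambda>q. x + p *\<^sub>R u + q *\<^sub>R v" and g = "\<lambda>y. ?f1 y u",
            OF _ d2[OF S]]) (auto intro!: derivative_eq_intros)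
    then show "DERIV G q :> ?f2 (x + p *\<^sub>R u + q *\<^sub>R v) v"
      unfolding has_field_derivative_def
      by (rule has_derivative_eq_rhs) (use S in \<open>simp add: fun_eq_iff lin2 algebra_simps\<close>)
  qed
  then obtain q where q: "0 < q" "q < s" "G s - G 0 = s * ?f2 (x + p *\<^sub>R u + q *\<^sub>R v) v"
    unfolding diff_zero by blast
  show thesis
  proof (rule that[OF p(1,2) q(1,2)])
    show "f (x + s *\<^sub>R u + s *\<^sub>R v) - f (x + s *\<^sub>R u) - f (x + s *\<^sub>R v) + f x =
        s\<^sup>2 * ?f2 (x + p *\<^sub>R u + q *\<^sub>R v) v"
      using p(3) q(3)[unfolded G_def] by (simp add: F_def power2_eq_square)
  qed
qed

text \<open>The intermediate point from the mean value theorem lies in a parallelogram shrinking to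
  \<open>x\<close>, and the second derivative is continuous there.\<close>

lemma second_difference_tendsto:
  fixes f :: "'a::real_normed_vector \<Rightarrow> real"
  assumes "C_on 2 S f" "open S" "x \<in> S"
  shows "((\<lambda>s. (f (x + s *\<^sub>R u + s *\<^sub>R v) - f (x + s *\<^sub>R u) - f (x + s *\<^sub>R v) + f x) / s\<^sup>2) \<longlongrightarrow>
      frechet_derivative (\<lambda>y. frechet_derivative f (at y) u) (at x) v) (at_right 0)"
    (is "(?Q \<longlongrightarrow> ?D x) _")
proof (rule tendstoI)
  fix e :: real assume "e > 0"
  have "continuous_on S ?D"
    using assms(1) by (auto simp: numeral_2_eq_2)
  then have "isCont ?D x"
    using assms continuous_on_eq_continuous_at by blast
  then obtain d0 where d0: "d0 > 0" "\<And>y. dist y x < d0 \<Longrightarrow> dist (?D y) (?D x) < e"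
    using \<open>e > 0\<close> unfolding continuous_at_eps_delta dist_norm by (metis )
  obtain d1 where d1: "d1 > 0" "ball x d1 \<subseteq> S"
    using assms openE by blast
  define d where "d = min d0 d1"
  have d: "d > 0" "\<And>y. dist y x < d \<Longrightarrow> y \<in> S \<and> dist (?D y) (?D x) < e"
    using d0 d1 by (auto simp: d_def subset_eq dist_commute)
  \<comment> \<open>The summand 1 keeps \<open>M\<close> positive even for \<open>u = v = 0\<close>
    and makes the estimate by \<open>s * M\<close> strict.\<close>
  define M where "M = norm u + norm v + 1"
  have M: "M > 0" by (simp add: M_def add_nonneg_pos)
  have near: "dist (x + p *\<^sub>R u + q *\<^sub>R v) x < d"
    if "0 \<le> p" "p \<le> s" "0 \<le> q" "q \<le> s" "0 < s" "s < d / M" for p q s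
  proof -
    have "dist (x + p *\<^sub>R u + q *\<^sub>R v) x \<le> p * norm u + q * norm v"
      using norm_triangle_ineq[of "p *\<^sub>R u" "q *\<^sub>R v"] that by (simp add: dist_norm algebra_simps)
    also have "\<dots> \<le> s * norm u + s * norm v"
      using that by (intro add_mono mult_right_mono) auto
    also have "\<dots> < s * M"
      using that by (simp add: M_def algebra_simps)
    also have "\<dots> < d"
      using that M by (simp add: field_simps)
    finally show ?thesis .
  qed
  have "dist (?Q s) (?D x) < e" if s: "0 < s" "s < d / M" for s
  proof -
    obtain p q where pq: "0 < p" "p < s" "0 < q" "q < s"
      "f (x + s *\<^sub>R u + s *\<^sub>R v) - f (x + s *\<^sub>R u) - f (x + s *\<^sub>R v) + f x =
        s\<^sup>2 * ?D (x + p *\<^sub>R u + q *\<^sub>R v)"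
      using second_difference_mean_value[OF assms(1) s(1), of x u v] near d(2) s by (metis )
    then have "?Q s = ?D (x + p *\<^sub>R u + q *\<^sub>R v)"
      using s by simp
    then show ?thesis
      using near[of p s q] d(2) pq s by simp
  qed
  then show "\<forall>\<^sub>F s in at_right 0. dist (?Q s) (?D x) < e"
    unfolding eventually_at_right_field using d(1) M by (intro exI[of _ "d / M"]) auto
qed

text \<open>The second difference does not change when \<open>u\<close> and \<open>v\<close> are
  exchanged, so both mixed derivatives are limits of the same quotient.\<close>

lemma frechet_derivative_symmetric:
  fixes f :: "'a::real_normed_vector \<Rightarrow> real"
  assumes "C_on 2 S f" "open S" "x \<in> S"
  shows "frechet_derivative (\<lambda>y. frechet_derivative f (at y) u) (at x) v =
      frechet_derivative (\<lambda>y. frechet_derivative f (at y) v) (at x) u"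
proof (rule tendsto_unique[OF trivial_limit_at_right_real])
  show "((\<lambda>s. (f (x + s *\<^sub>R u + s *\<^sub>R v) - f (x + s *\<^sub>R u) - f (x + s *\<^sub>R v) + f x) / s\<^sup>2) \<longlongrightarrow>
      frechet_derivative (\<lambda>y. frechet_derivative f (at y) u) (at x) v) (at_right 0)"
    by (rule second_difference_tendsto[OF assms])
  show "((\<lambda>s. (f (x + s *\<^sub>R u + s *\<^sub>R v) - f (x + s *\<^sub>R u) - f (x + s *\<^sub>R v) + f x) / s\<^sup>2) \<longlongrightarrow>
      frechet_derivative (\<lambda>y. frechet_derivative f (at y) v) (at x) u) (at_right 0)"
    using second_difference_tendsto[OF assms, of v u] by (simp add: algebra_simps)
qed

subsection \<open>Smooth cutoffs\<close>

text \<open>The power in front makes the family closed under differentiation up to linear combinations.\<close>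

definition flat_exp :: "nat \<Rightarrow> real \<Rightarrow> real"
  where "flat_exp n t = (if t > 0 then (1 / t) ^ n * exp (- (1 / t)) else 0)"

lemma flat_exp_bounds: "0 \<le> flat_exp 0 t" "flat_exp 0 t \<le> 1"
  by (auto simp: flat_exp_def)

text \<open>From the right, \<open>1 / t\<close> tends to infinity and the exponential beats every
  power; from the left the function vanishes.\<close>

lemma flat_exp_tendsto_0: "(flat_exp n \<longlongrightarrow> 0) (at 0)"
proof (rule filterlim_split_at)
  have "\<forall>\<^sub>F t in at_left 0. flat_exp n t = 0"
    by (auto simp: eventually_at_left_field flat_exp_def intro: exI[of _ "-1"])
  then show "(flat_exp n \<longlongrightarrow> 0) (at_left 0)"
    by (rule tendsto_eventually)
  have "((\<lambda>t::real. (1 / t) ^ n / exp (1 / t)) \<longlongrightarrow> 0) (at_right 0)"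
    using filterlim_compose[OF tendsto_power_div_exp_0[of n] filterlim_inverse_at_top_right]
    by (simp add: inverse_eq_divide)
  moreover have "\<forall>\<^sub>F t in at_right 0. (1 / t) ^ n / exp (1 / t) = flat_exp n t"
    by (auto simp: eventually_at_right_field flat_exp_def exp_minus field_simps intro!: exI[of _ 1])
  ultimately show "(flat_exp n \<longlongrightarrow> 0) (at_right 0)"
    by (rule Lim_transform_eventually)
qed

lemma flat_exp_has_real_derivative:
  "(flat_exp n has_real_derivative flat_exp (n + 2) t - real n * flat_exp (n + 1) t) (at t)"
proof (cases t "0::real" rule: linorder_cases)
  case less
  have "(flat_exp n has_real_derivative 0) (at t)"
    by (rule has_field_derivative_transform_within_open[of "\<lambda>_. 0" _ _ "{..<0}"])
       (use less in \<open>auto simp: flat_exp_def\<close>)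
  then show ?thesis using less by (simp add: flat_exp_def)
next
  case equal
  \<comment> \<open>Away from 0 the difference quotient at 0 is \<open>flat_exp (n + 1) t\<close>,
    so the limit already known for all exponents gives derivative 0.\<close>
  have "((\<lambda>t. flat_exp n t / t) \<longlongrightarrow> 0) (at 0)"
    by (rule Lim_transform_eventually[OF flat_exp_tendsto_0[of "n + 1"]])
       (auto simp: flat_exp_def eventually_at_filter)
  then show ?thesis
    using equal by (simp add: has_field_derivative_iff flat_exp_def)
next
  case greater
  have "((\<lambda>t. (1 / t) ^ n * exp (- (1 / t))) has_real_derivative
      flat_exp (n + 2) t - real n * flat_exp (n + 1) t) (at t)"
    using greater
    by (auto intro!: derivative_eq_intros simp: flat_exp_def field_simps power2_eq_square)
       (cases n; simp add: field_simps)
  then show ?thesis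
    by (rule has_field_derivative_transform_within_open[of _ _ _ "{0<..}"])
       (use greater in \<open>auto simp: flat_exp_def\<close>)
qed

lemma C_on_flat_exp: "C_on k UNIV (flat_exp n)"
proof (induction k arbitrary: n)
  case 0
  show ?case
    using DERIV_isCont[OF flat_exp_has_real_derivative]
    by (auto simp: continuous_on_eq_continuous_at)
next
  case (Suc k)
  have eq: "(flat_exp (n + 2) t - real n * flat_exp (n + 1) t) * v =
      v *\<^sub>R flat_exp (n + 2) t + (- (real n * v)) *\<^sub>R flat_exp (n + 1) t" for t v
    by (simp add: algebra_simps)
  show ?case
  proof (rule C_on_SucI[where f' = "\<lambda>t v. (flat_exp (n + 2) t - real n * flat_exp (n + 1) t) * v"])
    show "(flat_exp n has_derivative
        (*) (flat_exp (n + 2) t - real n * flat_exp (n + 1) t)) (at t)" for t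
      using flat_exp_has_real_derivative by (simp add: has_field_derivative_def)
    show "C_on k UNIV (\<lambda>t. (flat_exp (n + 2) t - real n * flat_exp (n + 1) t) * v)" for v
      unfolding eq
      by (intro C_on_add C_on_bounded_linear_compose[OF bounded_linear_scaleR_right] Suc.IH) auto
  qed auto
qed

subsection \<open>Change of variables in the complex plane\<close>

text \<open>An isometry identifying the plane with \<open>real^2\<close>, through which the change
  of variables theorem for Cartesian spaces is transported to \<open>complex\<close>.\<close>

definition vec2 :: "complex \<Rightarrow> real^2"
  where "vec2 z = (\<chi> i. if i = 1 then Re z else Im z)"

definition unvec2 :: "real^2 \<Rightarrow> complex"
  where "unvec2 v = Complex (v $ 1) (v $ 2)"

lemma vec2_nth [simp]: "vec2 z $ 1 = Re z" "vec2 z $ 2 = Im z"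
  by (simp_all add: vec2_def)

lemma unvec2_vec2 [simp]: "unvec2 (vec2 z) = z"
  by (simp add: unvec2_def complex_eq_iff)

lemma vec2_unvec2 [simp]: "vec2 (unvec2 v) = v"
  by (simp add: unvec2_def vec_eq_iff forall_2)

lemma bounded_linear_vec2: "bounded_linear vec2"
  by (rule linear_conv_bounded_linear[THEN iffD1], rule linearI)
     (simp_all add: vec_eq_iff forall_2)

lemma bounded_linear_unvec2: "bounded_linear unvec2"
  by (rule linear_conv_bounded_linear[THEN iffD1], rule linearI)
     (simp_all add: unvec2_def complex_eq_iff)

lemma norm_vec2 [simp]: "norm (vec2 z) = norm z"
  by (simp add: norm_vec_def L2_set_def UNIV_2 cmod_def)

lemma norm_unvec2 [simp]: "norm (unvec2 v) = norm v"
  using norm_vec2[of "unvec2 v"] by simp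

lemma mem_vec2_image: "v \<in> vec2 ` S \<longleftrightarrow> unvec2 v \<in> S"
  by (auto simp: image_iff intro: bexI[of _ "unvec2 v"])

lemma vec2_image_cbox: "vec2 ` cbox a b = cbox (vec2 a) (vec2 b)"
  by (auto simp: mem_vec2_image mem_box_cart forall_2 in_cbox_complex_iff unvec2_def)

lemma unvec2_image_cbox: "unvec2 ` cbox a b = cbox (unvec2 a) (unvec2 b)"
proof -
  have "unvec2 ` vec2 ` cbox (unvec2 a) (unvec2 b) = cbox (unvec2 a) (unvec2 b)"
    by (simp add: image_image)
  then show ?thesis
    by (simp add: vec2_image_cbox)
qed

lemma content_vec2_cbox: "measure lborel (cbox (vec2 a) (vec2 b)) = measure lborel (cbox a b)"
proof (cases "cbox a b = {}")
  case True
  then have "cbox (vec2 a) (vec2 b) = {}"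
    by (simp flip: vec2_image_cbox)
  with True show ?thesis by simp
next
  case False
  then have ne: "cbox (vec2 a) (vec2 b) \<noteq> {}"
    by (simp flip: vec2_image_cbox)
  have "Re a \<le> Re b" "Im a \<le> Im b"
    using False by (auto simp: box_ne_empty Basis_complex_def)
  then show ?thesis
    using ne by (simp add: content_cbox_cart UNIV_2 content_cbox' False Basis_complex_def)
qed

text \<open>Both \<open>vec2\<close> and \<open>unvec2\<close> map boxes onto boxes of equal
  content, so tagged divisions correspond and the scaling factor is 1.\<close>

lemma has_integral_vec2_cbox:
  fixes f :: "real^2 \<Rightarrow> 'b::banach"
  shows "((\<lambda>z. f (vec2 z)) has_integral y) (cbox a b) \<longleftrightarrow>
    (f has_integral y) (cbox (vec2 a) (vec2 b))"
proof
  assume "(f has_integral y) (cbox (vec2 a) (vec2 b))"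
  then have "((\<lambda>z. f (vec2 z)) has_integral (1 / 1) *\<^sub>R y) (unvec2 ` cbox (vec2 a) (vec2 b))"
    by (intro has_integral_twiddle)
       (auto intro: linear_continuous_at bounded_linear_vec2
         simp: vec2_image_cbox unvec2_image_cbox content_vec2_cbox)
  then show "((\<lambda>z. f (vec2 z)) has_integral y) (cbox a b)"
    by (simp add: unvec2_image_cbox)
next
  assume "((\<lambda>z. f (vec2 z)) has_integral y) (cbox a b)"
  then have "((\<lambda>v. f (vec2 (unvec2 v))) has_integral (1 / 1) *\<^sub>R y) (vec2 ` cbox a b)"
    using content_vec2_cbox[of "unvec2 _" "unvec2 _"]
    by (intro has_integral_twiddle[where f = "\<lambda>z. f (vec2 z)"])
       (auto intro: linear_continuous_at bounded_linear_unvec2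
         simp: vec2_image_cbox unvec2_image_cbox)
  then show "(f has_integral y) (cbox (vec2 a) (vec2 b))"
    by (simp add: vec2_image_cbox)
qed

text \<open>The integral over an arbitrary set is a limit over boxes containing large balls about 0.
  Since \<open>vec2\<close> preserves these balls and maps boxes onto boxes, the box case
  suffices.\<close>

lemma has_integral_vec2:
  fixes f :: "real^2 \<Rightarrow> 'b::banach"
  shows "((\<lambda>z. f (vec2 z)) has_integral y) S \<longleftrightarrow> (f has_integral y) (vec2 ` S)"
proof -
  have ball: "ball 0 B \<subseteq> cbox (vec2 a) (vec2 b) \<longleftrightarrow> ball 0 B \<subseteq> cbox a b" for B a b
  proof -
    have "vec2 ` ball 0 B = ball 0 B"
      by (auto simp: mem_vec2_image)
    moreover have "inj vec2"
      by (metis injI unvec2_vec2)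
    ultimately show ?thesis
      by (metis inj_image_subset_iff vec2_image_cbox)
  qed
  \<comment> \<open>By surjectivity of \<open>vec2\<close>, a quantifier over corners in
    \<open>real^2\<close> becomes one over complex corners.\<close>
  have all: "(\<forall>a b. P a b) \<longleftrightarrow> (\<forall>a b. P (vec2 a) (vec2 b))" for P :: "real^2 \<Rightarrow> real^2 \<Rightarrow> bool"
  proof (intro iffI allI)
    fix a b assume "\<forall>a b. P (vec2 a) (vec2 b)"
    then have "P (vec2 (unvec2 a)) (vec2 (unvec2 b))" by blast
    then show "P a b" by simp
  qed blast
  have "(\<forall>a b. ball 0 B \<subseteq> cbox a b \<longrightarrow>
        (\<exists>z. ((\<lambda>v. if v \<in> vec2 ` S then f v else 0) has_integral z) (cbox a b) \<and> norm (z - y) < e)) \<longleftrightarrow>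
      (\<forall>a b. ball 0 B \<subseteq> cbox a b \<longrightarrow>
        (\<exists>z. ((\<lambda>v. if v \<in> S then f (vec2 v) else 0) has_integral z) (cbox a b) \<and> norm (z - y) < e))"
    for B e
    by (subst all) (simp add: ball mem_vec2_image flip: has_integral_vec2_cbox)
  then show ?thesis
    unfolding has_integral'[of f] has_integral'[of "\<lambda>z. f (vec2 z)"] by simp
qed

lemma integrable_on_vec2:
  fixes f :: "real^2 \<Rightarrow> 'b::banach"
  shows "(\<lambda>z. f (vec2 z)) integrable_on S \<longleftrightarrow> f integrable_on vec2 ` S"
  by (simp add: integrable_on_def has_integral_vec2)

lemma integral_vec2:
  fixes f :: "real^2 \<Rightarrow> 'b::banach"
  shows "integral S (\<lambda>z. f (vec2 z)) = integral (vec2 ` S) f"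
  unfolding integral_def by (simp add: integrable_on_vec2 has_integral_vec2)

lemma absolutely_integrable_on_vec2:
  fixes f :: "real^2 \<Rightarrow> 'b::euclidean_space"
  shows "(\<lambda>z. f (vec2 z)) absolutely_integrable_on S \<longleftrightarrow> f absolutely_integrable_on vec2 ` S"
  by (simp add: absolutely_integrable_on_def integrable_on_vec2[of f]
      integrable_on_vec2[of "\<lambda>v. norm (f v)"])

text \<open>The determinant of a real-linear map of the plane in the basis 1, \<i>.\<close>

definition cdet :: "(complex \<Rightarrow> complex) \<Rightarrow> real"
  where "cdet L = Re (L 1) * Im (L \<i>) - Im (L 1) * Re (L \<i>)"

lemma det_vec2_conj:
  assumes "linear L"
  shows "det (matrix (\<lambda>v. vec2 (L (unvec2 v)))) = cdet L"
proof -
  have "unvec2 (axis 1 1) = 1" "unvec2 (axis 2 1) = \<i>"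
    by (auto simp: unvec2_def axis_def complex_eq_iff)
  then show ?thesis
    by (simp add: det_2 matrix_def cdet_def)
qed

text \<open>Conjugating \<open>g\<close> by \<open>vec2\<close> reduces the claim to
  \<open>has_absolute_integral_change_of_variables\<close>, whose integrands take values in
  \<open>real^'n\<close>.\<close>

lemma change_of_variables_complex_cart:
  fixes f :: "complex \<Rightarrow> real^'n" and g :: "complex \<Rightarrow> complex"
  assumes S: "S \<in> sets lebesgue"
    and der: "\<And>z. z \<in> S \<Longrightarrow> (g has_derivative g' z) (at z within S)"
    and inj: "inj_on g S"
  shows "(\<lambda>z. \<bar>cdet (g' z)\<bar> *\<^sub>R f (g z)) absolutely_integrable_on S \<and>
      integral S (\<lambda>z. \<bar>cdet (g' z)\<bar> *\<^sub>R f (g z)) = b \<longleftrightarrow>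
    f absolutely_integrable_on (g ` S) \<and> integral (g ` S) f = b"
proof -
  let ?G = "\<lambda>v. vec2 (g (unvec2 v))" and ?F = "\<lambda>v. f (unvec2 v)"
  let ?G' = "\<lambda>v w. vec2 (g' (unvec2 v) (unvec2 w))"
  have unv: "unvec2 ` vec2 ` S = S"
    by (simp add: image_image)
  have "vec2 ` S \<in> sets lebesgue"
    by (intro differentiable_image_in_sets_lebesgue S)
       (auto intro: bounded_linear_imp_differentiable_on bounded_linear_vec2)
  moreover have "(?G has_derivative ?G' v) (at v within vec2 ` S)" if "v \<in> vec2 ` S" for v
  proof -
    have "(unvec2 has_derivative unvec2) (at v within vec2 ` S)"
      by (rule bounded_linear_imp_has_derivative[OF bounded_linear_unvec2])
    moreover have "(g has_derivative g' (unvec2 v)) (at (unvec2 v) within unvec2 ` vec2 ` S)"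
      unfolding unv using der that by auto
    ultimately have "((\<lambda>v. g (unvec2 v)) has_derivative (\<lambda>w. g' (unvec2 v) (unvec2 w)))
        (at v within vec2 ` S)"
      by (rule has_derivative_in_compose)
    then show ?thesis
      by (rule bounded_linear.has_derivative[OF bounded_linear_vec2])
  qed
  moreover have "inj_on ?G (vec2 ` S)"
    by (rule inj_onI) (metis (no_types, lifting) imageE inj inj_onD unvec2_vec2)
  ultimately have cov: "(\<lambda>v. \<bar>det (matrix (?G' v))\<bar> *\<^sub>R ?F (?G v)) absolutely_integrable_on vec2 ` S \<and>
      integral (vec2 ` S) (\<lambda>v. \<bar>det (matrix (?G' v))\<bar> *\<^sub>R ?F (?G v)) = b \<longleftrightarrow>
    ?F absolutely_integrable_on (?G ` vec2 ` S) \<and> integral (?G ` vec2 ` S) ?F = b"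
    by (rule has_absolute_integral_change_of_variables)
  have img: "?G ` vec2 ` S = vec2 ` g ` S"
    by (simp add: image_image)
  have det: "\<bar>det (matrix (\<lambda>w. vec2 (g' z (unvec2 w))))\<bar> = \<bar>cdet (g' z)\<bar>" if "z \<in> S" for z
    using det_vec2_conj[OF has_derivative_linear[OF der[OF that]]] by simp
  have "(\<lambda>z. \<bar>det (matrix (?G' (vec2 z)))\<bar> *\<^sub>R f (g z)) absolutely_integrable_on S \<longleftrightarrow>
      (\<lambda>z. \<bar>cdet (g' z)\<bar> *\<^sub>R f (g z)) absolutely_integrable_on S"
    "integral S (\<lambda>z. \<bar>det (matrix (?G' (vec2 z)))\<bar> *\<^sub>R f (g z)) =
      integral S (\<lambda>z. \<bar>cdet (g' z)\<bar> *\<^sub>R f (g z))"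
    by (intro set_integrable_cong integral_cong refl; simp only: det unvec2_vec2)+
  with cov show ?thesis
    unfolding img absolutely_integrable_on_vec2[symmetric] integral_vec2[symmetric] unvec2_vec2
    by simp
qed

text \<open>A real integrand is viewed as one with values in \<open>real^1\<close>; a Euclidean one
  is then handled component by component.\<close>

theorem change_of_variables_complex:
  fixes f :: "complex \<Rightarrow> 'b::euclidean_space" and g :: "complex \<Rightarrow> complex"
  assumes S: "S \<in> sets lebesgue"
    and der: "\<And>z. z \<in> S \<Longrightarrow> (g has_derivative g' z) (at z within S)"
    and inj: "inj_on g S"
  shows "(\<lambda>z. \<bar>cdet (g' z)\<bar> *\<^sub>R f (g z)) absolutely_integrable_on S \<longleftrightarrow>
      f absolutely_integrable_on (g ` S)" (is ?int)
    and "f absolutely_integrable_on (g ` S) \<Longrightarrow>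
      integral S (\<lambda>z. \<bar>cdet (g' z)\<bar> *\<^sub>R f (g z)) = integral (g ` S) f"
proof -
  have real: "(\<lambda>z. \<bar>cdet (g' z)\<bar> * h (g z)) absolutely_integrable_on S \<and>
      integral S (\<lambda>z. \<bar>cdet (g' z)\<bar> * h (g z)) = b \<longleftrightarrow>
      h absolutely_integrable_on (g ` S) \<and> integral (g ` S) h = b" for h :: "complex \<Rightarrow> real" and b
  proof -
    have "(\<lambda>z. \<bar>cdet (g' z)\<bar> *\<^sub>R (vec (h (g z)) :: real^1)) absolutely_integrable_on S \<and>
        integral S (\<lambda>z. \<bar>cdet (g' z)\<bar> *\<^sub>R (vec (h (g z)) :: real^1)) = vec b \<longleftrightarrow>
      (\<lambda>z. vec (h z) :: real^1) absolutely_integrable_on (g ` S) \<and>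
        integral (g ` S) (\<lambda>z. vec (h z) :: real^1) = vec b"
      by (rule change_of_variables_complex_cart[OF assms])
    then show ?thesis
      by (simp add: absolutely_integrable_on_1_iff integral_on_1_eq)
  qed
  show iff: ?int
    unfolding absolutely_integrable_componentwise_iff[where f = "\<lambda>z. \<bar>cdet (g' z)\<bar> *\<^sub>R f (g z)"]
      absolutely_integrable_componentwise_iff[where f = f] inner_scaleR_left
    using real[of "\<lambda>z. f z \<bullet> _"] by (intro ball_cong refl) blast
  assume int: "f absolutely_integrable_on (g ` S)"
  show "integral S (\<lambda>z. \<bar>cdet (g' z)\<bar> *\<^sub>R f (g z)) = integral (g ` S) f"
  proof (rule euclidean_eqI)
    fix b :: 'b assume b: "b \<in> Basis"
    have "(\<lambda>z. f z \<bullet> b) absolutely_integrable_on (g ` S)"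
      using int b absolutely_integrable_componentwise_iff by blast
    then have "integral S (\<lambda>z. \<bar>cdet (g' z)\<bar> * (f (g z) \<bullet> b)) = integral (g ` S) (\<lambda>z. f z \<bullet> b)"
      using real[of "\<lambda>z. f z \<bullet> b"] by blast
    moreover have "f integrable_on (g ` S)" "(\<lambda>z. \<bar>cdet (g' z)\<bar> *\<^sub>R f (g z)) integrable_on S"
      using int iff set_lebesgue_integral_eq_integral(1) by blast+
    ultimately show "integral S (\<lambda>z. \<bar>cdet (g' z)\<bar> *\<^sub>R f (g z)) \<bullet> b = integral (g ` S) f \<bullet> b"
      by (simp flip: integral_component_eq)
  qed
qed

subsection \<open>Uniqueness of weak derivatives\<close>

lemma smooth_on_imp_C_on: "smooth_on S f \<Longrightarrow> C_on k S f"
  by (simp add: smooth_on_def)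

section \<open>Smooth cutoffs of boxes\<close>

lemma C_on_box_cutoff_factor: "C_on k (UNIV :: complex set) (\<lambda>z. flat_exp 0 (s * (L z - c)))"
  if "bounded_linear L" for L :: "complex \<Rightarrow> real"
proof (rule C_on_compose[where T = UNIV and f = "flat_exp 0", OF open_UNIV subset_UNIV _ C_on_flat_exp])
  have "C_on k UNIV (\<lambda>z. s * L z + - (s * c))"
    by (intro C_on_add C_on_const C_on_bounded_linear_compose[OF bounded_linear_mult_right]
        C_on_bounded_linear that) auto
  then show "C_on k UNIV (\<lambda>z. s * (L z - c))"
    by (simp add: algebra_simps)
qed

text \<open>Each factor is positive exactly on the inner side of one edge of the box. The slope
  \<open>Suc n\<close> drives the product to the indicator of the open box as \<open>n\<close>
  grows.\<close>

definition box_cutoff :: "complex \<Rightarrow> complex \<Rightarrow> nat \<Rightarrow> complex \<Rightarrow> real"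
  where "box_cutoff a b n z =
    flat_exp 0 (real (Suc n) * (Re z - Re a)) * flat_exp 0 (- real (Suc n) * (Re z - Re b)) *
    (flat_exp 0 (real (Suc n) * (Im z - Im a)) * flat_exp 0 (- real (Suc n) * (Im z - Im b)))"

lemma C_on_box_cutoff: "C_on k UNIV (box_cutoff a b n)"
  unfolding box_cutoff_def
  by (intro C_on_mult C_on_box_cutoff_factor bounded_linear_Re bounded_linear_Im open_UNIV)

lemma flat_exp_scaled_eq_0: "flat_exp 0 (real (Suc n) * t) = 0 \<longleftrightarrow> t \<le> 0"
  by (simp add: flat_exp_def not_less mult_le_0_iff zero_less_mult_iff del: of_nat_Suc)

lemma box_cutoff_nonzero: "box_cutoff a b n z \<noteq> 0 \<longleftrightarrow> z \<in> box a b"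
  unfolding box_cutoff_def in_box_complex_iff minus_mult_left[symmetric] minus_mult_right minus_diff_eq
  by (simp add: flat_exp_scaled_eq_0 not_le conj_ac del: of_nat_Suc)

lemma box_cutoff_bounds: "0 \<le> box_cutoff a b n z" "box_cutoff a b n z \<le> 1"
  unfolding box_cutoff_def
  by (intro mult_nonneg_nonneg mult_le_one flat_exp_bounds)+

lemma flat_exp_scaled_tendsto:
  assumes "t > 0"
  shows "(\<lambda>n. flat_exp 0 (real (Suc n) * t)) \<longlonglongrightarrow> 1"
proof -
  have "(\<lambda>n. - (inverse (real (Suc n)) * inverse t)) \<longlonglongrightarrow> - (0 * inverse t)"
    by (intro tendsto_intros LIMSEQ_inverse_real_of_nat)
  then have "(\<lambda>n. exp (- (inverse (real (Suc n)) * inverse t))) \<longlonglongrightarrow> exp (- (0 * inverse t))"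
    by (rule tendsto_exp)
  then show ?thesis
    using assms by (simp add: flat_exp_def divide_inverse del: of_nat_Suc)
qed

lemma box_cutoff_tendsto: "(\<lambda>n. box_cutoff a b n z) \<longlonglongrightarrow> (if z \<in> box a b then 1 else 0)"
proof (cases "z \<in> box a b")
  case True
  have "flat_exp 0 (- real (Suc n) * (u - v)) = flat_exp 0 (real (Suc n) * (v - u))" for n u v
    by (simp add: algebra_simps)
  then have "(\<lambda>n. box_cutoff a b n z) \<longlonglongrightarrow> 1 * 1 * (1 * 1)"
    unfolding box_cutoff_def using True
    by (simp only:) (intro tendsto_mult flat_exp_scaled_tendsto; simp add: in_box_complex_iff)
  with True show ?thesis by simp
next
  case False
  then have "box_cutoff a b n z = 0" for n
    using box_cutoff_nonzero by blast
  with False show ?thesis by simp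
qed

lemma test_functionI:
  assumes "compact K" "K \<subseteq> \<Omega>" "\<And>z. \<phi> z \<noteq> 0 \<Longrightarrow> z \<in> K" "\<And>k. C_on k UNIV \<phi>"
  shows "test_function \<Omega> \<phi>"
proof -
  have "closure {z. \<phi> z \<noteq> 0} \<subseteq> K"
    by (intro closure_minimal) (use assms compact_imp_closed in auto)
  then show ?thesis
    unfolding test_function_def smooth_on_def
    using assms compact_Int_closed[OF assms(1) closed_closure[of "{z. \<phi> z \<noteq> 0}"]]
    by (auto simp: Int_absorb1)
qed

lemma test_function_box_cutoff:
  assumes "cbox a b \<subseteq> \<Omega>"
  shows "test_function \<Omega> (box_cutoff a b n)"
  by (rule test_functionI[OF compact_cbox assms _ C_on_box_cutoff])
     (use box_subset_cbox box_cutoff_nonzero in blast)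

section \<open>Products with continuous functions and the fundamental lemma of the calculus of
  variations\<close>

lemma absolutely_integrable_continuous_scaleR:
  fixes c :: "complex \<Rightarrow> real" and f :: "complex \<Rightarrow> complex"
  assumes "compact K" "continuous_on K c" "f absolutely_integrable_on K"
  shows "(\<lambda>z. c z *\<^sub>R f z) absolutely_integrable_on K"
proof (rule absolutely_integrable_bounded_measurable_product[where h = "(*\<^sub>R)" and f = c and g = f])
  show "bilinear ((*\<^sub>R) :: real \<Rightarrow> complex \<Rightarrow> complex)"
    by (simp add: bilinear_conv_bounded_bilinear bounded_bilinear_scaleR)
  show "K \<in> sets lebesgue"
    using assms(1) by (simp add: compact_imp_closed)
  then show "c \<in> borel_measurable (lebesgue_on K)"
    using assms(2) by (simp add: continuous_imp_measurable_on_sets_lebesgue)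
  show "bounded (c ` K)"
    using assms by (simp add: compact_continuous_image compact_imp_bounded)
qed (fact assms)

lemma indicator_scaleR_cong_support:
  assumes "K \<subseteq> \<Omega>" "\<And>z. z \<in> \<Omega> \<Longrightarrow> f z \<noteq> (0 :: complex) \<Longrightarrow> z \<in> K"
  shows "(\<lambda>z. indicator \<Omega> z *\<^sub>R f z) = (\<lambda>z. indicator K z *\<^sub>R f z)"
  using assms by (auto simp: indicator_def fun_eq_iff)

lemma test_product_integrable:
  assumes "locally_integrable \<Omega> f" "compact K" "K \<subseteq> \<Omega>" "continuous_on K c"
    and "\<And>z. c z \<noteq> 0 \<Longrightarrow> z \<in> K"
  shows "(\<lambda>z. c z *\<^sub>R f z) absolutely_integrable_on \<Omega>"
proof -
  have "(\<lambda>z. c z *\<^sub>R f z) absolutely_integrable_on K"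
    using assms by (intro absolutely_integrable_continuous_scaleR) (auto simp: locally_integrable_def)
  moreover have "(\<lambda>z. indicator \<Omega> z *\<^sub>R (c z *\<^sub>R f z)) = (\<lambda>z. indicator K z *\<^sub>R (c z *\<^sub>R f z))"
    by (rule indicator_scaleR_cong_support) (use assms in auto)
  ultimately show ?thesis
    by (simp add: set_integrable_def)
qed

text \<open>The cutoffs of the box are test functions with values between 0 and 1 that converge to
  the indicator of the open box. Dominated convergence with majorant \<open>norm (g z)\<close>
  passes to the limit, and the boundary of the box is negligible.\<close>

lemma integral_cbox_eq_0_if_test_orthogonal:
  assumes g: "locally_integrable \<Omega> g"
    and orth: "\<And>\<phi>. test_function \<Omega> \<phi> \<Longrightarrow> (LINT z:\<Omega>|lebesgue. \<phi> z *\<^sub>R g z) = 0"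
    and sub: "cbox a b \<subseteq> \<Omega>"
  shows "integral (cbox a b) g = 0"
proof -
  have gint: "g absolutely_integrable_on cbox a b"
    using g sub by (simp add: locally_integrable_def)
  let ?f = "\<lambda>n z. box_cutoff a b n z *\<^sub>R g z"
  have fint: "?f n absolutely_integrable_on cbox a b" for n
    by (rule absolutely_integrable_continuous_scaleR[OF compact_cbox _ gint],
        rule continuous_on_subset[OF C_on_imp_continuous_on[OF C_on_box_cutoff] subset_UNIV])
  have zero: "integral (cbox a b) (?f n) = 0" for n
  proof -
    have "(\<lambda>z. indicator \<Omega> z *\<^sub>R ?f n z) = (\<lambda>z. indicator (cbox a b) z *\<^sub>R ?f n z)"
      by (rule indicator_scaleR_cong_support[OF sub])
         (use box_cutoff_nonzero box_subset_cbox in fastforce)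
    then have "(LINT z:cbox a b|lebesgue. ?f n z) = (LINT z:\<Omega>|lebesgue. ?f n z)"
      by (simp add: set_lebesgue_integral_def)
    also have "\<dots> = 0"
      by (rule orth[OF test_function_box_cutoff[OF sub]])
    finally show ?thesis
      using set_lebesgue_integral_eq_integral(2)[OF fint] by simp
  qed
  have "(\<lambda>n. integral (cbox a b) (?f n)) \<longlonglongrightarrow>
      integral (cbox a b) (\<lambda>z. (if z \<in> box a b then 1 else 0) *\<^sub>R g z)"
  proof (rule dominated_convergence)
    show "?f n integrable_on cbox a b" for n
      using fint set_lebesgue_integral_eq_integral(1) by blast
    show "(\<lambda>z. norm (g z)) integrable_on cbox a b"
      using gint absolutely_integrable_on_def by blast
    show "norm (?f n z) \<le> norm (g z)" for n z
      using box_cutoff_bounds[of a b n z] by (simp add: mult_left_le_one_le)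
    show "(\<lambda>n. ?f n z) \<longlonglongrightarrow> (if z \<in> box a b then 1 else 0) *\<^sub>R g z" for z
      by (intro tendsto_intros box_cutoff_tendsto)
  qed
  then have "integral (cbox a b) (\<lambda>z. (if z \<in> box a b then 1 else 0) *\<^sub>R g z) = 0"
    unfolding zero using LIMSEQ_unique tendsto_const by blast
  moreover have "integral (cbox a b) (\<lambda>z. (if z \<in> box a b then 1 else 0) *\<^sub>R g z) = integral (cbox a b) g"
  proof (rule integral_spike[OF negligible_frontier_interval])
    show "g z = (if z \<in> box a b then 1 else 0) *\<^sub>R g z" if "z \<in> cbox a b - (cbox a b - box a b)" for z
      using that by auto
  qed
  ultimately show ?thesis by simp
qed

text \<open>By Lebesgue differentiation, at almost every point \<open>g\<close> is the limit of its
  averages over small squares with that point as lower corner, and these averages vanish.\<close>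

lemma negligible_nonzero_if_integral_cbox_eq_0:
  fixes g :: "complex \<Rightarrow> complex"
  assumes g: "g absolutely_integrable_on cbox a b"
    and zero: "\<And>c d. cbox c d \<subseteq> cbox a b \<Longrightarrow> integral (cbox c d) g = 0"
  shows "negligible {z \<in> cbox a b. g z \<noteq> 0}"
proof -
  \<comment> \<open>Extension by zero gives integrability on all boxes, as the differentiation
    theorem requires; inside \<open>cbox a b\<close> nothing changes.\<close>
  define f where "f z = (if z \<in> cbox a b then g z else 0)" for z
  have "f integrable_on UNIV"
    unfolding f_def integrable_restrict_UNIV using g set_lebesgue_integral_eq_integral(1) by blast
  then have fint: "f integrable_on cbox c d" for c d
    using integrable_on_subcbox by blast
  obtain N where N: "negligible N" and conv: "\<And>x e. \<lbrakk>x \<notin> N; 0 < e\<rbrakk> \<Longrightarrow>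
      \<exists>d>0. \<forall>h. 0 < h \<and> h < d \<longrightarrow>
        norm (integral (cbox x (x + h *\<^sub>R One)) f /\<^sub>R h ^ DIM(complex) - f x) < e"
    using integrable_ccontinuous_explicit[OF fint] by blast
  have "g x = 0" if x: "x \<in> box a b" "x \<notin> N" for x
  proof (rule ccontr)
    assume "g x \<noteq> 0"
    then obtain d where d: "d > 0" "\<And>h. 0 < h \<Longrightarrow> h < d \<Longrightarrow>
        norm (integral (cbox x (x + h *\<^sub>R One)) f /\<^sub>R h ^ DIM(complex) - f x) < norm (g x)"
      using conv[OF x(2), of "norm (g x)"] by auto
    \<comment> \<open>The distances from \<open>x\<close> to the upper edges bound \<open>h\<close>,
      so that the square stays in the box; \<open>d / 2\<close> ensures \<open>h < d\<close>. A
      vanishing average then contradicts the error bound \<open>norm (g x)\<close>.\<close>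
    define h where "h = min (d / 2) (min (Re b - Re x) (Im b - Im x))"
    have h: "0 < h" "h < d"
      using d(1) x(1) by (auto simp: h_def in_box_complex_iff)
    have "cbox x (x + h *\<^sub>R One) \<subseteq> cbox a b"
      using x(1) by (auto simp: in_cbox_complex_iff in_box_complex_iff Basis_complex_def h_def)
    then have "integral (cbox x (x + h *\<^sub>R One)) f = 0"
      using zero by (subst integral_cong[where g = g]) (auto simp: f_def)
    then show False
      using d(2)[OF h] x(1) subsetD[OF box_subset_cbox x(1)] by (simp add: f_def)
  qed
  then have "{z \<in> cbox a b. g z \<noteq> 0} \<subseteq> N \<union> (cbox a b - box a b)"
    by blast
  then show ?thesis
    using N negligible_frontier_interval negligible_Un negligible_subset by metis
qed

text \<open>An open set is a countable union of closed boxes, and on each of them the exceptional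
  set is negligible.\<close>

lemma AE_eq_0_if_test_orthogonal:
  assumes "open \<Omega>" and g: "locally_integrable \<Omega> g"
    and orth: "\<And>\<phi>. test_function \<Omega> \<phi> \<Longrightarrow> (LINT z:\<Omega>|lebesgue. \<phi> z *\<^sub>R g z) = 0"
  shows "AE z in lebesgue. z \<in> \<Omega> \<longrightarrow> g z = 0"
proof -
  obtain D where D: "countable D" "D \<subseteq> Pow \<Omega>" "\<And>X. X \<in> D \<Longrightarrow> \<exists>a b. X = cbox a b" "\<Union>D = \<Omega>"
    using open_countable_Union_open_cbox[OF assms(1)] by metis
  have "negligible {z \<in> X. g z \<noteq> 0}" if X: "X \<in> D" for X
  proof -
    obtain a b where ab: "X = cbox a b"
      using D(3) X by blast
    have "cbox a b \<subseteq> \<Omega>"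
      using D(2) X ab by blast
    then show ?thesis
      unfolding ab
      using g integral_cbox_eq_0_if_test_orthogonal[OF g orth]
      by (intro negligible_nonzero_if_integral_cbox_eq_0) (auto simp: locally_integrable_def)
  qed
  then have "negligible (\<Union>((\<lambda>X. {z \<in> X. g z \<noteq> 0}) ` D))"
    using D(1) by (intro negligible_countable_Union) auto
  moreover have "\<Union>((\<lambda>X. {z \<in> X. g z \<noteq> 0}) ` D) = {z. \<not> (z \<in> \<Omega> \<longrightarrow> g z = 0)}"
    using D(4) by blast
  ultimately show ?thesis
    by (simp add: eventually_ae_filter_negligible) blast
qed

lemma locally_integrable_diff:
  "locally_integrable \<Omega> f \<Longrightarrow> locally_integrable \<Omega> g \<Longrightarrow> locally_integrable \<Omega> (\<lambda>z. f z - g z)"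
  unfolding locally_integrable_def by (auto intro: set_integral_diff)

lemma test_function_times_integrable:
  assumes "locally_integrable \<Omega> f" "test_function \<Omega> \<phi>"
  shows "(\<lambda>z. \<phi> z *\<^sub>R f z) absolutely_integrable_on \<Omega>"
proof (rule test_product_integrable[OF assms(1), where K = "closure {z. \<phi> z \<noteq> 0}"])
  show "continuous_on (closure {z. \<phi> z \<noteq> 0}) \<phi>"
    using assms(2) C_on_imp_continuous_on[OF smooth_on_imp_C_on] continuous_on_subset subset_UNIV
    unfolding test_function_def by metis
  show "z \<in> closure {z. \<phi> z \<noteq> 0}" if "\<phi> z \<noteq> 0" for z
    by (rule subsetD[OF closure_subset]) (simp add: that)
qed (use assms in \<open>auto simp: test_function_def\<close>)

text \<open>The difference of two weak derivatives is orthogonal to every test function.\<close>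

theorem weak_derivative_unique:
  assumes "open \<Omega>" "is_weak_derivative \<Omega> v f g" "is_weak_derivative \<Omega> v f g'"
  shows "AE z in lebesgue. z \<in> \<Omega> \<longrightarrow> g z = g' z"
proof -
  have loc: "locally_integrable \<Omega> g" "locally_integrable \<Omega> g'"
    using assms by (auto simp: is_weak_derivative_def)
  have "AE z in lebesgue. z \<in> \<Omega> \<longrightarrow> g z - g' z = 0"
  proof (rule AE_eq_0_if_test_orthogonal[OF assms(1) locally_integrable_diff[OF loc]])
    fix \<phi> assume \<phi>: "test_function \<Omega> \<phi>"
    have "(LINT z:\<Omega>|lebesgue. \<phi> z *\<^sub>R g z) = (LINT z:\<Omega>|lebesgue. \<phi> z *\<^sub>R g' z)"
      using assms(2,3) \<phi> unfolding is_weak_derivative_def by (metis neg_equal_iff_equal)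
    then show "(LINT z:\<Omega>|lebesgue. \<phi> z *\<^sub>R (g z - g' z)) = 0"
      using loc[THEN test_function_times_integrable, OF \<phi>]
      by (simp add: scaleR_diff_right set_integral_diff)
  qed
  then show ?thesis by simp
qed

lemma is_weak_derivative_weak_derivative:
  "is_weak_derivative \<Omega> v f g \<Longrightarrow> is_weak_derivative \<Omega> v f (weak_derivative \<Omega> v f)"
  unfolding weak_derivative_def by (rule someI[of "is_weak_derivative \<Omega> v f"])

subsection \<open>The chain rule for weak derivatives\<close>

lemma cdet_compose:
  assumes "linear L"
  shows "cdet (\<lambda>u. L (M u)) = cdet L * cdet M"
proof -
  have "L w = Re w *\<^sub>R L 1 + Im w *\<^sub>R L \<i>" for w
  proof -
    have "w = Re w *\<^sub>R 1 + Im w *\<^sub>R \<i>"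
      by (simp add: complex_eq_iff)
    then have "L w = L (Re w *\<^sub>R 1 + Im w *\<^sub>R \<i>)"
      by (rule arg_cong)
    then show ?thesis
      by (simp only: linear_add[OF assms] linear_cmul[OF assms])
  qed
  from this[of "M 1"] this[of "M \<i>"] show ?thesis
    by (simp add: cdet_def algebra_simps)
qed

text \<open>A purely algebraic identity in the values of the derivative at 1 and \<i>.\<close>

lemma wirtinger_jacobian_eq_cdet: "wirtinger_jacobian f z = cdet (frechet_derivative f (at z))"
  unfolding wirtinger_jacobian_def wirtinger_z_def wirtinger_zbar_def cdet_def cmod_power2
  by (simp add: power2_eq_square field_simps)

lemma frechet_derivative_eqI:
  "(f has_derivative f') (at x) \<Longrightarrow> frechet_derivative f (at x) u = f' u"
  by (metis frechet_derivative_at)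

text \<open>Off the closed support the function is locally zero, so its derivative has support in
  the same compact set.\<close>

lemma test_function_derivative:
  assumes "test_function \<Omega> \<phi>"
  shows "test_function \<Omega> (\<lambda>z. frechet_derivative \<phi> (at z) v)"
proof (rule test_functionI)
  let ?K = "closure {z. \<phi> z \<noteq> 0}"
  show "compact ?K" "?K \<subseteq> \<Omega>"
    using assms by (auto simp: test_function_def)
  show "C_on k UNIV (\<lambda>z. frechet_derivative \<phi> (at z) v)" for k
    using assms smooth_on_imp_C_on[of UNIV \<phi> "Suc k"] by (simp add: test_function_def)
  show "z \<in> ?K" if "frechet_derivative \<phi> (at z) v \<noteq> 0" for z
  proof (rule ccontr)
    assume "z \<notin> ?K"
    have "(\<phi> has_derivative (\<lambda>_. 0)) (at z)"
    proof (rule has_derivative_transform_within_open[of "\<lambda>_. 0" _ _ _ "- ?K"])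
      show "0 = \<phi> w" if "w \<in> - ?K" for w
        using that closure_subset[of "{z. \<phi> z \<noteq> 0}"] by auto
    qed (use \<open>z \<notin> ?K\<close> in auto)
    then have "frechet_derivative \<phi> (at z) = (\<lambda>_. 0)"
      by (metis frechet_derivative_at)
    with that show False by simp
  qed
qed

lemma locally_integrable_add:
  "locally_integrable \<Omega> f \<Longrightarrow> locally_integrable \<Omega> g \<Longrightarrow> locally_integrable \<Omega> (\<lambda>z. f z + g z)"
  unfolding locally_integrable_def by auto

lemma locally_integrable_scaleR:
  "locally_integrable \<Omega> f \<Longrightarrow> continuous_on \<Omega> c \<Longrightarrow> locally_integrable \<Omega> (\<lambda>z. c z *\<^sub>R f z)"
  unfolding locally_integrable_def
  by (auto intro: absolutely_integrable_continuous_scaleR continuous_on_subset)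

text \<open>The inverse is a parameter of its own, so that the two maps can exchange roles.\<close>

locale smooth_diffeo_pair =
  fixes \<Omega> :: "complex set" and \<xi> \<eta> :: "complex \<Rightarrow> complex"
  assumes open_dom: "open \<Omega>"
    and smooth_fwd: "smooth_on \<Omega> \<xi>" and smooth_inv: "smooth_on \<Omega> \<eta>"
    and fwd_in: "z \<in> \<Omega> \<Longrightarrow> \<xi> z \<in> \<Omega>" and inv_in: "z \<in> \<Omega> \<Longrightarrow> \<eta> z \<in> \<Omega>"
    and inv_fwd: "z \<in> \<Omega> \<Longrightarrow> \<eta> (\<xi> z) = z" and fwd_inv: "z \<in> \<Omega> \<Longrightarrow> \<xi> (\<eta> z) = z"
    and det_fwd_pos: "z \<in> \<Omega> \<Longrightarrow> cdet (frechet_derivative \<xi> (at z)) > 0"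
begin

section \<open>Derivatives of the pair and substitution along the inverse\<close>

abbreviation D\<xi> where "D\<xi> z \<equiv> frechet_derivative \<xi> (at z)"
abbreviation D\<eta> where "D\<eta> z \<equiv> frechet_derivative \<eta> (at z)"

lemma has_derivative_fwd: "z \<in> \<Omega> \<Longrightarrow> (\<xi> has_derivative D\<xi> z) (at z)"
  by (rule C_on_Suc_has_derivative[OF smooth_on_imp_C_on[OF smooth_fwd]])

lemma has_derivative_inv: "z \<in> \<Omega> \<Longrightarrow> (\<eta> has_derivative D\<eta> z) (at z)"
  by (rule C_on_Suc_has_derivative[OF smooth_on_imp_C_on[OF smooth_inv]])

lemma image_inv: "\<eta> ` \<Omega> = \<Omega>"
proof
  show "\<Omega> \<subseteq> \<eta> ` \<Omega>"
    by (metis inv_fwd imageI fwd_in subsetI)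
qed (use inv_in in auto)

lemma inj_fwd: "inj_on \<xi> \<Omega>"
  using inv_fwd by (rule inj_on_inverseI)

lemma inj_inv: "inj_on \<eta> \<Omega>"
  using fwd_inv by (rule inj_on_inverseI)

lemma continuous_on_D_fwd: "continuous_on \<Omega> (\<lambda>z. D\<xi> z v)"
  using smooth_on_imp_C_on[OF smooth_fwd, of 1] by simp

lemma D_fwd_D_inv:
  assumes "w \<in> \<Omega>"
  shows "D\<xi> (\<eta> w) (D\<eta> w u) = u"
proof -
  have "((\<lambda>w. \<xi> (\<eta> w)) has_derivative (\<lambda>u. D\<xi> (\<eta> w) (D\<eta> w u))) (at w)"
    by (rule has_derivative_compose[OF has_derivative_inv[OF assms]
          has_derivative_fwd[OF inv_in[OF assms]]])
  then have "((\<lambda>w. w) has_derivative (\<lambda>u. D\<xi> (\<eta> w) (D\<eta> w u))) (at w)"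
    by (rule has_derivative_transform_within_open[OF _ open_dom assms]) (rule fwd_inv)
  then have "(\<lambda>u. D\<xi> (\<eta> w) (D\<eta> w u)) = (\<lambda>u. u)"
    using has_derivative_unique has_derivative_ident by blast
  then show ?thesis by metis
qed

text \<open>The two derivatives are inverse to each other, so their determinants multiply to
  1.\<close>

lemma det_inv_pos:
  assumes "w \<in> \<Omega>"
  shows "cdet (D\<eta> w) > 0"
proof -
  have "cdet (D\<xi> (\<eta> w)) * cdet (D\<eta> w) = cdet (\<lambda>u. u)"
    using cdet_compose[OF has_derivative_linear[OF has_derivative_fwd[OF inv_in[OF assms]]], of "D\<eta> w"]
    by (simp add: D_fwd_D_inv assms)
  also have "\<dots> > 0"
    by (simp add: cdet_def)
  finally show ?thesis
    using det_fwd_pos[OF inv_in[OF assms]] zero_less_mult_pos by blast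
qed

text \<open>The inverse maps \<Omega> onto itself, and positivity of its determinant removes the
  absolute value.\<close>

lemma change_of_variables_inv:
  fixes f :: "complex \<Rightarrow> 'b::euclidean_space"
  shows "(\<lambda>w. cdet (D\<eta> w) *\<^sub>R f (\<eta> w)) absolutely_integrable_on \<Omega> \<longleftrightarrow>
      f absolutely_integrable_on \<Omega>"
    and "f absolutely_integrable_on \<Omega> \<Longrightarrow>
      integral \<Omega> (\<lambda>w. cdet (D\<eta> w) *\<^sub>R f (\<eta> w)) = integral \<Omega> f"
proof -
  have S: "\<Omega> \<in> sets lebesgue"
    using open_dom by simp
  have der: "(\<eta> has_derivative D\<eta> w) (at w within \<Omega>)" if "w \<in> \<Omega>" for w
    using has_derivative_inv[OF that] has_derivative_at_withinI by blast
  have abs: "\<bar>cdet (D\<eta> w)\<bar> *\<^sub>R f (\<eta> w) = cdet (D\<eta> w) *\<^sub>R f (\<eta> w)" if "w \<in> \<Omega>" for w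
    using det_inv_pos[OF that] by simp
  have "(\<lambda>w. \<bar>cdet (D\<eta> w)\<bar> *\<^sub>R f (\<eta> w)) absolutely_integrable_on \<Omega> \<longleftrightarrow>
      (\<lambda>w. cdet (D\<eta> w) *\<^sub>R f (\<eta> w)) absolutely_integrable_on \<Omega>"
    by (intro set_integrable_cong refl abs)
  moreover have "integral \<Omega> (\<lambda>w. \<bar>cdet (D\<eta> w)\<bar> *\<^sub>R f (\<eta> w)) =
      integral \<Omega> (\<lambda>w. cdet (D\<eta> w) *\<^sub>R f (\<eta> w))"
    by (intro integral_cong abs)
  ultimately show "(\<lambda>w. cdet (D\<eta> w) *\<^sub>R f (\<eta> w)) absolutely_integrable_on \<Omega> \<longleftrightarrow>
      f absolutely_integrable_on \<Omega>"
    and "f absolutely_integrable_on \<Omega> \<Longrightarrow>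
      integral \<Omega> (\<lambda>w. cdet (D\<eta> w) *\<^sub>R f (\<eta> w)) = integral \<Omega> f"
    using change_of_variables_complex[OF S der inj_inv, of f] by (simp_all add: image_inv)
qed

text \<open>With the roles exchanged, results about substitution along \<eta> also give substitution
  along \<xi>.\<close>

lemma flip: "smooth_diffeo_pair \<Omega> \<eta> \<xi>"
  by (intro smooth_diffeo_pair.intro open_dom smooth_fwd smooth_inv fwd_in inv_in inv_fwd fwd_inv det_inv_pos)

text \<open>Change of variables gives integrability of the composition weighted by the Jacobian. On
  a compact set the reciprocal of the Jacobian is continuous, hence the weight can be divided
  out.\<close>

lemma locally_integrable_compose:
  assumes "locally_integrable \<Omega> f"
  shows "locally_integrable \<Omega> (\<lambda>z. f (\<xi> z))"
  unfolding locally_integrable_def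
proof (intro allI impI, elim conjE)
  fix K assume K: "compact K" "K \<subseteq> \<Omega>"
  have "continuous_on K \<xi>"
    using C_on_imp_continuous_on[OF smooth_on_imp_C_on[OF smooth_fwd]] K continuous_on_subset by blast
  then have "compact (\<xi> ` K)" "\<xi> ` K \<subseteq> \<Omega>"
    using K fwd_in by (auto intro: compact_continuous_image)
  then have "f absolutely_integrable_on \<xi> ` K"
    using assms by (auto simp: locally_integrable_def)
  then have int: "(\<lambda>z. \<bar>cdet (D\<xi> z)\<bar> *\<^sub>R f (\<xi> z)) absolutely_integrable_on K"
    using K by (subst change_of_variables_complex(1))
      (auto simp: compact_imp_closed
        intro: has_derivative_at_withinI has_derivative_fwd inj_on_subset[OF inj_fwd])
  have "(\<lambda>z. inverse \<bar>cdet (D\<xi> z)\<bar> *\<^sub>R (\<bar>cdet (D\<xi> z)\<bar> *\<^sub>R f (\<xi> z))) absolutely_integrable_on K"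
  proof (rule absolutely_integrable_continuous_scaleR[OF K(1) _ int])
    have "continuous_on \<Omega> (\<lambda>z. cdet (D\<xi> z))"
      unfolding cdet_def by (intro continuous_intros continuous_on_D_fwd)
    then have "continuous_on \<Omega> (\<lambda>z. inverse \<bar>cdet (D\<xi> z)\<bar>)"
      by (intro continuous_intros) (auto dest: det_fwd_pos)
    then show "continuous_on K (\<lambda>z. inverse \<bar>cdet (D\<xi> z)\<bar>)"
      using K(2) continuous_on_subset by blast
  qed
  moreover have "inverse \<bar>cdet (D\<xi> z)\<bar> *\<^sub>R (\<bar>cdet (D\<xi> z)\<bar> *\<^sub>R f (\<xi> z)) = f (\<xi> z)" if "z \<in> K" for z
    using det_fwd_pos[of z] that K(2) by auto
  then have "(\<lambda>z. inverse \<bar>cdet (D\<xi> z)\<bar> *\<^sub>R (\<bar>cdet (D\<xi> z)\<bar> *\<^sub>R f (\<xi> z))) absolutely_integrable_on K \<longleftrightarrow>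
      (\<lambda>z. f (\<xi> z)) absolutely_integrable_on K"
    by (intro set_integrable_cong refl)
  ultimately show "(\<lambda>z. f (\<xi> z)) absolutely_integrable_on K"
    by satx
qed

text \<open>The function vanishes off the image under \<xi> of the support of \<open>\<phi>\<close>,
  a compact subset of \<Omega>. It is smooth on \<Omega> and, being zero there, on the complement of
  this image; these two open sets cover the plane.\<close>

lemma test_function_pullback:
  assumes \<phi>: "test_function \<Omega> \<phi>" and a: "\<And>k. C_on k \<Omega> a"
  shows "test_function \<Omega> (\<lambda>w. if w \<in> \<Omega> then \<phi> (\<eta> w) * a w else 0)" (is "test_function _ ?F")
proof (rule test_functionI)
  let ?K = "closure {z. \<phi> z \<noteq> 0}"
  have K: "compact ?K" "?K \<subseteq> \<Omega>"
    using \<phi> by (auto simp: test_function_def)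
  have "continuous_on ?K \<xi>"
    using C_on_imp_continuous_on[OF smooth_on_imp_C_on[OF smooth_fwd]] K continuous_on_subset by blast
  then show cpt: "compact (\<xi> ` ?K)"
    using K(1) by (rule compact_continuous_image)
  show "\<xi> ` ?K \<subseteq> \<Omega>"
    using K(2) fwd_in by auto
  show supp: "w \<in> \<xi> ` ?K" if "?F w \<noteq> 0" for w
  proof (rule image_eqI)
    show "w = \<xi> (\<eta> w)"
      using that fwd_inv[of w] by (auto split: if_splits)
    have "\<phi> (\<eta> w) \<noteq> 0"
      using that by (auto split: if_splits)
    then show "\<eta> w \<in> ?K"
      by (intro subsetD[OF closure_subset]) simp
  qed
  show "C_on k UNIV ?F" for k
  proof -
    have "C_on k UNIV \<phi>"
      using \<phi> by (simp add: test_function_def smooth_on_def)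
    then have "C_on k \<Omega> (\<lambda>w. \<phi> (\<eta> w))"
      by (rule C_on_compose[OF open_dom subset_UNIV smooth_on_imp_C_on[OF smooth_inv]])
    then have "C_on k \<Omega> (\<lambda>w. \<phi> (\<eta> w) * a w)"
      by (intro C_on_mult open_dom a)
    then have "C_on k \<Omega> ?F"
      by (rule C_on_cong[OF open_dom, rotated]) simp
    moreover have opn: "open (- \<xi> ` ?K)"
      using cpt by (simp add: compact_imp_closed open_Compl)
    have "0 = ?F w" if "w \<in> - \<xi> ` ?K" for w
      using supp[of w] that by (metis ComplD)
    from C_on_cong[OF opn this C_on_const] have "C_on k (- \<xi> ` ?K) ?F" .
    ultimately have "C_on k (\<Omega> \<union> - \<xi> ` ?K) ?F"
      by (intro C_on_Un open_dom opn)
    moreover have "\<Omega> \<union> - \<xi> ` ?K = UNIV"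
      using K(2) fwd_in by auto
    ultimately show ?thesis by simp
  qed
qed

lemma pullback_derivative:
  assumes \<phi>: "test_function \<Omega> \<phi>" and a: "C_on 1 \<Omega> a" and w: "w \<in> \<Omega>"
  shows "frechet_derivative (\<lambda>w. if w \<in> \<Omega> then \<phi> (\<eta> w) * a w else 0) (at w) u =
    frechet_derivative \<phi> (at (\<eta> w)) (D\<eta> w u) * a w + \<phi> (\<eta> w) * frechet_derivative a (at w) u"
proof -
  have "(\<phi> has_derivative frechet_derivative \<phi> (at (\<eta> w))) (at (\<eta> w))"
    using \<phi> C_on_Suc_has_derivative[OF smooth_on_imp_C_on[of UNIV \<phi> "Suc 0"]]
    by (simp add: test_function_def)
  then have "((\<lambda>w. \<phi> (\<eta> w)) has_derivative (\<lambda>u. frechet_derivative \<phi> (at (\<eta> w)) (D\<eta> w u))) (at w)"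
    using has_derivative_compose[OF has_derivative_inv[OF w]] by blast
  moreover have "(a has_derivative frechet_derivative a (at w)) (at w)"
    using a w by (simp add: frechet_derivative_works[symmetric])
  ultimately have "((\<lambda>w. \<phi> (\<eta> w) * a w) has_derivative
      (\<lambda>u. \<phi> (\<eta> w) * frechet_derivative a (at w) u +
           frechet_derivative \<phi> (at (\<eta> w)) (D\<eta> w u) * a w)) (at w)"
    by (rule has_derivative_mult)
  then have "((\<lambda>w. if w \<in> \<Omega> then \<phi> (\<eta> w) * a w else 0) has_derivative
      (\<lambda>u. \<phi> (\<eta> w) * frechet_derivative a (at w) u +
           frechet_derivative \<phi> (at (\<eta> w)) (D\<eta> w u) * a w)) (at w)"
    by (rule has_derivative_transform_within_open[OF _ open_dom w]) simp
  from frechet_derivative_eqI[OF this] show ?thesis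
    by simp
qed

section \<open>The divergence free field of cofactors\<close>

text \<open>The components of the vector field \<open>w \<mapsto> det D\<eta>(w) \<cdot> (D\<eta>(w))\<inverse> v\<close>, written with the
  cofactors of \<open>D\<eta>\<close>.\<close>

definition cof_re :: "complex \<Rightarrow> complex \<Rightarrow> real"
  where "cof_re v w = Re v * frechet_derivative (\<lambda>w. Im (\<eta> w)) (at w) \<i> -
    Im v * frechet_derivative (\<lambda>w. Re (\<eta> w)) (at w) \<i>"

definition cof_im :: "complex \<Rightarrow> complex \<Rightarrow> real"
  where "cof_im v w = Im v * frechet_derivative (\<lambda>w. Re (\<eta> w)) (at w) 1 -
    Re v * frechet_derivative (\<lambda>w. Im (\<eta> w)) (at w) 1"

lemma C_on_Re_inv: "C_on k \<Omega> (\<lambda>w. Re (\<eta> w))" and C_on_Im_inv: "C_on k \<Omega> (\<lambda>w. Im (\<eta> w))"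
  by (intro C_on_bounded_linear_compose[OF bounded_linear_Re] open_dom
        C_on_bounded_linear_compose[OF bounded_linear_Im] smooth_on_imp_C_on[OF smooth_inv])+

lemma C_on_D_Re_inv: "C_on k \<Omega> (\<lambda>w. frechet_derivative (\<lambda>w. Re (\<eta> w)) (at w) u)"
  and C_on_D_Im_inv: "C_on k \<Omega> (\<lambda>w. frechet_derivative (\<lambda>w. Im (\<eta> w)) (at w) u)"
  using C_on_Re_inv[of "Suc k"] C_on_Im_inv[of "Suc k"] by auto

lemma D_Re_inv: "w \<in> \<Omega> \<Longrightarrow> frechet_derivative (\<lambda>w. Re (\<eta> w)) (at w) u = Re (D\<eta> w u)"
  by (rule frechet_derivative_eqI[OF bounded_linear.has_derivative[OF bounded_linear_Re has_derivative_inv]])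

lemma D_Im_inv: "w \<in> \<Omega> \<Longrightarrow> frechet_derivative (\<lambda>w. Im (\<eta> w)) (at w) u = Im (D\<eta> w u)"
  by (rule frechet_derivative_eqI[OF bounded_linear.has_derivative[OF bounded_linear_Im has_derivative_inv]])

lemma C_on_linear_combination:
  fixes f g :: "complex \<Rightarrow> real"
  assumes "C_on k \<Omega> f" "C_on k \<Omega> g"
  shows "C_on k \<Omega> (\<lambda>w. r * f w - s * g w)"
proof -
  have "C_on k \<Omega> (\<lambda>w. r * f w + (- s) * g w)"
    by (intro C_on_add C_on_mult C_on_const assms open_dom)
  then show ?thesis by simp
qed

lemma C_on_cof: "C_on k \<Omega> (cof_re v)" "C_on k \<Omega> (cof_im v)"
  unfolding cof_re_def[abs_def] cof_im_def[abs_def]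
  by (intro C_on_linear_combination C_on_D_Re_inv C_on_D_Im_inv)+

lemma frechet_derivative_linear_combination:
  fixes f g :: "complex \<Rightarrow> real"
  assumes "C_on 1 \<Omega> f" "C_on 1 \<Omega> g" "w \<in> \<Omega>"
  shows "frechet_derivative (\<lambda>w. r * f w - s * g w) (at w) u =
    r * frechet_derivative f (at w) u - s * frechet_derivative g (at w) u"
proof -
  have "((\<lambda>w. r * f w - s * g w) has_derivative
      (\<lambda>u. r * frechet_derivative f (at w) u - s * frechet_derivative g (at w) u)) (at w)"
    using assms
    by (intro has_derivative_diff has_derivative_mult_right) (auto simp: frechet_derivative_works[symmetric])
  from frechet_derivative_eqI[OF this] show ?thesis
    by simp
qed

text \<open>The Piola identity: each of \<open>Re v\<close> and \<open>Im v\<close> multiplies a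
  difference of mixed second partial derivatives of one component of \<eta>, taken in the two
  orders.\<close>

lemma cof_divergence_free:
  assumes "w \<in> \<Omega>"
  shows "frechet_derivative (cof_re v) (at w) 1 + frechet_derivative (cof_im v) (at w) \<i> = 0"
  unfolding cof_re_def[abs_def] cof_im_def[abs_def]
  by (simp add: frechet_derivative_linear_combination C_on_D_Re_inv C_on_D_Im_inv assms
      frechet_derivative_symmetric[OF C_on_Re_inv open_dom assms, of \<i> 1]
      frechet_derivative_symmetric[OF C_on_Im_inv open_dom assms, of \<i> 1] del: C_on.simps)

text \<open>This is the rule that a matrix times its adjugate is the determinant times the identity,
  applied to \<open>v\<close>.\<close>

lemma D_inv_cof:
  assumes "w \<in> \<Omega>"
  shows "cof_re v w *\<^sub>R D\<eta> w 1 + cof_im v w *\<^sub>R D\<eta> w \<i> = cdet (D\<eta> w) *\<^sub>R v"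
  using assms by (simp add: complex_eq_iff cof_re_def cof_im_def D_Re_inv D_Im_inv cdet_def algebra_simps)

text \<open>Applying the derivative of \<xi> to the adjugate identity cancels that of \<eta>. It
  links the cofactor field to the coefficients in the chain rule.\<close>

lemma cof_eq_D_fwd:
  assumes "w \<in> \<Omega>"
  shows "cof_re v w = cdet (D\<eta> w) * Re (D\<xi> (\<eta> w) v)" "cof_im v w = cdet (D\<eta> w) * Im (D\<xi> (\<eta> w) v)"
proof -
  have lin: "linear (D\<xi> (\<eta> w))"
    using has_derivative_fwd[OF inv_in[OF assms]] has_derivative_linear by blast
  have "cdet (D\<eta> w) *\<^sub>R D\<xi> (\<eta> w) v = D\<xi> (\<eta> w) (cof_re v w *\<^sub>R D\<eta> w 1 + cof_im v w *\<^sub>R D\<eta> w \<i>)"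
    by (simp only: D_inv_cof[OF assms] linear_cmul[OF lin])
  also have "\<dots> = cof_re v w *\<^sub>R 1 + cof_im v w *\<^sub>R \<i>"
    by (simp only: linear_add[OF lin] linear_cmul[OF lin] D_fwd_D_inv[OF assms])
  finally show "cof_re v w = cdet (D\<eta> w) * Re (D\<xi> (\<eta> w) v)"
    "cof_im v w = cdet (D\<eta> w) * Im (D\<xi> (\<eta> w) v)"
    by (simp_all add: complex_eq_iff)
qed

theorem weak_chain_rule:
  assumes g1: "is_weak_derivative \<Omega> 1 f g1" and g2: "is_weak_derivative \<Omega> \<i> f g2"
  shows "is_weak_derivative \<Omega> v (\<lambda>z. f (\<xi> z))
    (\<lambda>z. Re (D\<xi> z v) *\<^sub>R g1 (\<xi> z) + Im (D\<xi> z v) *\<^sub>R g2 (\<xi> z))"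
    (is "is_weak_derivative _ _ _ ?G")
  unfolding is_weak_derivative_def
proof (intro conjI allI impI)
  have loc: "locally_integrable \<Omega> f" "locally_integrable \<Omega> g1" "locally_integrable \<Omega> g2"
    using assms by (auto simp: is_weak_derivative_def)
  show "locally_integrable \<Omega> (\<lambda>z. f (\<xi> z))"
    by (rule locally_integrable_compose[OF loc(1)])
  show locG: "locally_integrable \<Omega> ?G"
    by (intro locally_integrable_add locally_integrable_scaleR locally_integrable_compose loc
        continuous_intros continuous_on_D_fwd)
  fix \<phi> assume \<phi>: "test_function \<Omega> \<phi>"
  let ?D\<phi> = "\<lambda>z. frechet_derivative \<phi> (at z)"
  \<comment> \<open>\<open>F1\<close> and \<open>F2\<close> are the components of the cofactor field
    multiplied by the pulled back test function.\<close>
  define F1 where "F1 = (\<lambda>w. if w \<in> \<Omega> then \<phi> (\<eta> w) * cof_re v w else 0)"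
  define F2 where "F2 = (\<lambda>w. if w \<in> \<Omega> then \<phi> (\<eta> w) * cof_im v w else 0)"
  have F: "test_function \<Omega> F1" "test_function \<Omega> F2"
    unfolding F1_def F2_def by (intro test_function_pullback \<phi> C_on_cof)+
  note dF = F(1)[THEN test_function_derivative, of 1] F(2)[THEN test_function_derivative, of \<i>]
  note intL = test_function_times_integrable[OF loc(1) dF(1)]
    test_function_times_integrable[OF loc(1) dF(2)]
  note intR = test_function_times_integrable[OF loc(2) F(1)]
    test_function_times_integrable[OF loc(3) F(2)]
  let ?L = "\<lambda>w. frechet_derivative F1 (at w) 1 *\<^sub>R f w + frechet_derivative F2 (at w) \<i> *\<^sub>R f w"
  let ?R = "\<lambda>w. F1 w *\<^sub>R g1 w + F2 w *\<^sub>R g2 w"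
  let ?l = "\<lambda>z. ?D\<phi> z v *\<^sub>R f (\<xi> z)" and ?r = "\<lambda>z. \<phi> z *\<^sub>R ?G z"
  \<comment> \<open>The divergence of \<open>(F1, F2)\<close> is computed by the product rule. The
    term with the divergence of the cofactors drops out, and the adjugate identity turns the rest
    into the Jacobian times the derivative of \<open>\<phi>\<close> along \<open>v\<close>.\<close>
  have L: "?L w = cdet (D\<eta> w) *\<^sub>R ?l (\<eta> w)" if w: "w \<in> \<Omega>" for w
  proof -
    have lin: "linear (?D\<phi> (\<eta> w))"
      using \<phi> C_on_Suc_has_derivative[OF smooth_on_imp_C_on[of UNIV \<phi> "Suc 0"]]
      by (auto simp: test_function_def intro: has_derivative_linear)
    have "frechet_derivative F1 (at w) 1 + frechet_derivative F2 (at w) \<i> =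
        ?D\<phi> (\<eta> w) (D\<eta> w 1) * cof_re v w + ?D\<phi> (\<eta> w) (D\<eta> w \<i>) * cof_im v w +
        \<phi> (\<eta> w) * (frechet_derivative (cof_re v) (at w) 1 + frechet_derivative (cof_im v) (at w) \<i>)"
      unfolding F1_def F2_def pullback_derivative[OF \<phi> C_on_cof(1) w] pullback_derivative[OF \<phi> C_on_cof(2) w]
      by (simp only: distrib_left add_ac)
    also have "\<dots> = ?D\<phi> (\<eta> w) (cof_re v w *\<^sub>R D\<eta> w 1 + cof_im v w *\<^sub>R D\<eta> w \<i>)"
      by (simp add: cof_divergence_free[OF w] linear_add[OF lin] linear_cmul[OF lin] mult.commute)
    also have "\<dots> = cdet (D\<eta> w) * ?D\<phi> (\<eta> w) v"
      by (simp add: D_inv_cof[OF w] linear_cmul[OF lin])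
    finally show ?thesis
      by (simp add: fwd_inv[OF w] flip: scaleR_add_left)
  qed
  have R: "?R w = cdet (D\<eta> w) *\<^sub>R ?r (\<eta> w)" if w: "w \<in> \<Omega>" for w
    using w by (simp add: F1_def F2_def cof_eq_D_fwd fwd_inv scaleR_add_right mult_ac)
  have "?L absolutely_integrable_on \<Omega>"
    using intL by (rule set_integral_add)
  moreover have "?L absolutely_integrable_on \<Omega> \<longleftrightarrow>
      (\<lambda>w. cdet (D\<eta> w) *\<^sub>R ?l (\<eta> w)) absolutely_integrable_on \<Omega>"
    by (intro set_integrable_cong refl L)
  \<comment> \<open>Integrability is pulled back through the substitution from \<open>?L\<close>,
    whose summands are products of \<open>f\<close> with test functions.\<close>
  ultimately have l: "?l absolutely_integrable_on \<Omega>"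
    using change_of_variables_inv(1)[of ?l] by satx
  have r: "?r absolutely_integrable_on \<Omega>"
    by (rule test_function_times_integrable[OF locG \<phi>])
  have "(LINT z:\<Omega>|lebesgue. ?l z) = integral \<Omega> ?l"
    by (rule set_lebesgue_integral_eq_integral(2)[OF l])
  also have "\<dots> = integral \<Omega> ?L"
    unfolding change_of_variables_inv(2)[OF l, symmetric] by (intro integral_cong L[symmetric])
  also have "\<dots> = (LINT w:\<Omega>|lebesgue. ?L w)"
    by (rule set_lebesgue_integral_eq_integral(2)[symmetric, OF set_integral_add(1)[OF intL]])
  \<comment> \<open>The weak derivative of \<open>f\<close> along 1 is tested with
    \<open>F1\<close>, the one along \<i> with \<open>F2\<close>.\<close>
  also have "\<dots> = - (LINT w:\<Omega>|lebesgue. F1 w *\<^sub>R g1 w) - (LINT w:\<Omega>|lebesgue. F2 w *\<^sub>R g2 w)"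
    using g1 g2 F unfolding set_integral_add(2)[OF intL] by (simp add: is_weak_derivative_def)
  also have "\<dots> = - (LINT w:\<Omega>|lebesgue. ?R w)"
    unfolding set_integral_add(2)[OF intR] by simp
  also have "(LINT w:\<Omega>|lebesgue. ?R w) = integral \<Omega> ?R"
    by (rule set_lebesgue_integral_eq_integral(2)[OF set_integral_add(1)[OF intR]])
  also have "\<dots> = integral \<Omega> ?r"
    unfolding change_of_variables_inv(2)[OF r, symmetric] by (intro integral_cong R)
  also have "\<dots> = (LINT z:\<Omega>|lebesgue. ?r z)"
    by (rule set_lebesgue_integral_eq_integral(2)[OF r, symmetric])
  finally show "(LINT z:\<Omega>|lebesgue. ?l z) = - (LINT z:\<Omega>|lebesgue. ?r z)" .
qed

end

subsection \<open>Comparison of the energies\<close>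

text \<open>The parallelogram law: the energy density is half the squared norm of the real
  gradient.\<close>

lemma norm_wirtinger_pair:
  "(norm ((a - \<i> * b) / 2))\<^sup>2 + (norm ((a + \<i> * b) / 2))\<^sup>2 = ((norm a)\<^sup>2 + (norm b)\<^sup>2) / 2"
  unfolding cmod_power2 by (simp add: power2_eq_square field_simps)

text \<open>Uniqueness replaces the representatives picked by \<open>weak_derivative\<close> with
  any explicitly known weak derivatives, almost everywhere.\<close>

lemma weak_gradient_AE:
  assumes "open \<Omega>" "is_weak_derivative \<Omega> 1 f g1" "is_weak_derivative \<Omega> \<i> f g2"
  shows "AE z in lebesgue. z \<in> \<Omega> \<longrightarrow>
    weak_z \<Omega> f z = (g1 z - \<i> * g2 z) / 2 \<and> weak_zbar \<Omega> f z = (g1 z + \<i> * g2 z) / 2"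
  using weak_derivative_unique[OF assms(1) is_weak_derivative_weak_derivative[OF assms(2)] assms(2)]
    weak_derivative_unique[OF assms(1) is_weak_derivative_weak_derivative[OF assms(3)] assms(3)]
  by eventually_elim (simp add: weak_z_def weak_zbar_def)

lemma dirichlet_energy_eq:
  assumes "open \<Omega>" "is_weak_derivative \<Omega> 1 f g1" "is_weak_derivative \<Omega> \<i> f g2"
  shows "dirichlet_energy \<Omega> f =
    (\<integral>\<^sup>+z\<in>\<Omega>. ennreal (((norm (g1 z))\<^sup>2 + (norm (g2 z))\<^sup>2) / 2) \<partial>lebesgue)"
  unfolding dirichlet_energy_def
proof (rule nn_integral_cong_AE)
  show "AE z in lebesgue.
      ennreal ((norm (weak_z \<Omega> f z))\<^sup>2 + (norm (weak_zbar \<Omega> f z))\<^sup>2) * indicator \<Omega> z =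
      ennreal (((norm (g1 z))\<^sup>2 + (norm (g2 z))\<^sup>2) / 2) * indicator \<Omega> z"
    using weak_gradient_AE[OF assms]
  proof eventually_elim
    case (elim z)
    show ?case
    proof (cases "z \<in> \<Omega>")
      case True
      with elim have "weak_z \<Omega> f z = (g1 z - \<i> * g2 z) / 2" "weak_zbar \<Omega> f z = (g1 z + \<i> * g2 z) / 2"
        by blast+
      then show ?thesis
        by (simp only: norm_wirtinger_pair)
    qed simp
  qed
qed

lemma nn_integral_absolutely_integrable:
  fixes f :: "complex \<Rightarrow> real"
  assumes "f absolutely_integrable_on S" "\<And>z. z \<in> S \<Longrightarrow> 0 \<le> f z"
  shows "(\<integral>\<^sup>+z\<in>S. ennreal (f z) \<partial>lebesgue) = ennreal (integral S f)"
proof -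
  have "(\<integral>\<^sup>+z\<in>S. ennreal (f z) \<partial>lebesgue) = (\<integral>\<^sup>+z. ennreal (indicator S z *\<^sub>R f z) \<partial>lebesgue)"
    by (intro nn_integral_cong) (simp add: indicator_def)
  also have "\<dots> = ennreal (LINT z:S|lebesgue. f z)"
    using assms unfolding set_lebesgue_integral_def set_integrable_def
    by (intro nn_integral_eq_integral) (auto simp: indicator_def)
  also have "\<dots> = ennreal (integral S f)"
    by (simp add: set_lebesgue_integral_eq_integral(2)[OF assms(1)])
  finally show ?thesis .
qed

text \<open>The hypothesis forces \<open>a = \<i> * b\<close> or \<open>a = - \<i> * b\<close>. Then
  \<open>a\<close> and \<open>b\<close> are orthogonal of equal length, so a real combination with
  coefficients \<open>x\<close>, \<open>y\<close> has squared norm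
  \<open>x\<^sup>2 + y\<^sup>2\<close> times that of \<open>b\<close>, and a bound on the
  determinant by the squared Hilbert-Schmidt norm remains.\<close>

lemma conformal_gradient_energy:
  fixes a b :: complex
  assumes "(a - \<i> * b) / 2 * cnj ((a + \<i> * b) / 2) = 0"
  shows "cdet L * (((norm a)\<^sup>2 + (norm b)\<^sup>2) / 2) \<le>
    ((norm (Re (L 1) *\<^sub>R a + Im (L 1) *\<^sub>R b))\<^sup>2 + (norm (Re (L \<i>) *\<^sub>R a + Im (L \<i>) *\<^sub>R b))\<^sup>2) / 2"
proof -
  define p q r s where pqrs: "p = Re (L 1)" "q = Im (L 1)" "r = Re (L \<i>)" "s = Im (L \<i>)"
  have "a - \<i> * b = 0 \<or> a + \<i> * b = 0"
    using assms unfolding mult_eq_0_iff complex_cnj_zero_iff divide_eq_0_iff by simp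
  then have "a = \<i> * b \<or> a = - (\<i> * b)"
    by (simp add: add_eq_0_iff2)
  then have ab: "(Re a = - Im b \<and> Im a = Re b) \<or> (Re a = Im b \<and> Im a = - Re b)"
    by auto
  have norms: "(norm a)\<^sup>2 + (norm b)\<^sup>2 = 2 * (norm b)\<^sup>2"
    using ab unfolding cmod_power2 by (auto simp: power2_eq_square)
  have comb: "(norm (x *\<^sub>R a + y *\<^sub>R b))\<^sup>2 = (x\<^sup>2 + y\<^sup>2) * (norm b)\<^sup>2" for x y
    using ab unfolding cmod_power2 by (auto simp: power2_eq_square algebra_simps)
  \<comment> \<open>This sum of squares is the Hilbert-Schmidt norm squared minus twice the
    determinant.\<close>
  have "0 \<le> (p - s)\<^sup>2 + (q + r)\<^sup>2"
    by simp
  then have "2 * (p * s - q * r) \<le> (p\<^sup>2 + q\<^sup>2) + (r\<^sup>2 + s\<^sup>2)"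
    by (simp add: power2_eq_square algebra_simps)
  then have "2 * (p * s - q * r) * (norm b)\<^sup>2 \<le> ((p\<^sup>2 + q\<^sup>2) + (r\<^sup>2 + s\<^sup>2)) * (norm b)\<^sup>2"
    by (rule mult_right_mono) simp
  then show ?thesis
    unfolding norms comb cdet_def pqrs[symmetric] by (simp add: algebra_simps)
qed

context smooth_diffeo_pair
begin

text \<open>The exceptional set of the composition lies in the image under \<eta> of a null set, and
  differentiable maps of the plane send null sets to null sets.\<close>

lemma AE_compose:
  assumes "AE w in lebesgue. w \<in> \<Omega> \<longrightarrow> P w"
  shows "AE z in lebesgue. z \<in> \<Omega> \<longrightarrow> P (\<xi> z)"
proof -
  obtain N where N: "negligible N" "{w. \<not> (w \<in> \<Omega> \<longrightarrow> P w)} \<subseteq> N"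
    using assms unfolding eventually_ae_filter_negligible by auto
  have "negligible (\<eta> ` {w. \<not> (w \<in> \<Omega> \<longrightarrow> P w)})"
  proof (rule negligible_differentiable_image_negligible)
    show "negligible {w. \<not> (w \<in> \<Omega> \<longrightarrow> P w)}"
      using N negligible_subset by blast
    show "\<eta> differentiable_on {w. \<not> (w \<in> \<Omega> \<longrightarrow> P w)}"
      unfolding differentiable_on_def
      using has_derivative_inv by (auto intro: differentiableI has_derivative_at_withinI)
  qed simp
  moreover have "{z. \<not> (z \<in> \<Omega> \<longrightarrow> P (\<xi> z))} \<subseteq> \<eta> ` {w. \<not> (w \<in> \<Omega> \<longrightarrow> P w)}"
    using fwd_in inv_fwd by (force intro: rev_image_eqI)
  ultimately show ?thesis
    unfolding eventually_ae_filter_negligible by blast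
qed

theorem dirichlet_energy_compose_ge:
  assumes h: "h \<in> sobolev_W12 \<Omega>"
    and hopf: "AE z in lebesgue. z \<in> \<Omega> \<longrightarrow> hopf_product \<Omega> h z = 0"
  shows "dirichlet_energy \<Omega> h \<le> dirichlet_energy \<Omega> (\<lambda>z. h (\<xi> z))"
proof -
  \<comment> \<open>In this interpretation \<open>change_of_variables_inv\<close> is the
    substitution along \<xi>, which moves the energy of \<open>h\<close> to the variable of the
    composition.\<close>
  interpret inv: smooth_diffeo_pair \<Omega> \<eta> \<xi>
    by (rule flip)
  obtain g1 g2 where g: "is_weak_derivative \<Omega> 1 h g1" "is_weak_derivative \<Omega> \<i> h g2"
    and sq: "square_integrable \<Omega> g1" "square_integrable \<Omega> g2"
    using h by (auto simp: sobolev_W12_def)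
  let ?f = "\<lambda>w. ((norm (g1 w))\<^sup>2 + (norm (g2 w))\<^sup>2) / 2"
  let ?G = "\<lambda>v z. Re (D\<xi> z v) *\<^sub>R g1 (\<xi> z) + Im (D\<xi> z v) *\<^sub>R g2 (\<xi> z)"
  have int: "?f absolutely_integrable_on \<Omega>"
    using sq by (auto simp: square_integrable_def intro!: set_integrable_divide set_integral_add(1))
  have "dirichlet_energy \<Omega> h = ennreal (integral \<Omega> ?f)"
    unfolding dirichlet_energy_eq[OF open_dom g] by (rule nn_integral_absolutely_integrable[OF int]) simp
  also have "integral \<Omega> ?f = integral \<Omega> (\<lambda>z. cdet (D\<xi> z) * ?f (\<xi> z))"
    using inv.change_of_variables_inv(2)[OF int] by simp
  also have "ennreal \<dots> = (\<integral>\<^sup>+z\<in>\<Omega>. ennreal (cdet (D\<xi> z) * ?f (\<xi> z)) \<partial>lebesgue)"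
  proof (rule nn_integral_absolutely_integrable[symmetric])
    show "(\<lambda>z. cdet (D\<xi> z) * ?f (\<xi> z)) absolutely_integrable_on \<Omega>"
      using inv.change_of_variables_inv(1)[of ?f] int by simp
    show "0 \<le> cdet (D\<xi> z) * ?f (\<xi> z)" if "z \<in> \<Omega>" for z
      using det_fwd_pos[OF that] by (intro mult_nonneg_nonneg) auto
  qed
  \<comment> \<open>The densities are compared at almost every point, with the Hopf condition
    carried along \<xi>. Nonnegative integrals allow the right side to be infinite.\<close>
  also have "\<dots> \<le> (\<integral>\<^sup>+z\<in>\<Omega>. ennreal (((norm (?G 1 z))\<^sup>2 + (norm (?G \<i> z))\<^sup>2) / 2) \<partial>lebesgue)"
  proof (rule nn_integral_mono_AE)
    have "AE w in lebesgue. w \<in> \<Omega> \<longrightarrow> (g1 w - \<i> * g2 w) / 2 * cnj ((g1 w + \<i> * g2 w) / 2) = 0"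
      using hopf weak_gradient_AE[OF open_dom g]
      by eventually_elim (auto simp only: hopf_product_def)
    from AE_compose[OF this]
    show "AE z in lebesgue. ennreal (cdet (D\<xi> z) * ?f (\<xi> z)) * indicator \<Omega> z \<le>
        ennreal (((norm (?G 1 z))\<^sup>2 + (norm (?G \<i> z))\<^sup>2) / 2) * indicator \<Omega> z"
    proof eventually_elim
      case (elim z)
      show ?case
      proof (cases "z \<in> \<Omega>")
        case True
        from conformal_gradient_energy[OF elim[rule_format, OF True], of "D\<xi> z"] True show ?thesis
          by (simp add: ennreal_leI)
      qed simp
    qed
  qed
  also have "\<dots> = dirichlet_energy \<Omega> (\<lambda>z. h (\<xi> z))"
    by (rule dirichlet_energy_eq[OF open_dom weak_chain_rule[OF g] weak_chain_rule[OF g], symmetric])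
  finally show ?thesis .
qed

end

theorem corollary1p5:
  fixes \<Omega> :: "complex set" and h :: "complex \<Rightarrow> complex"
  assumes "open \<Omega>" and "connected \<Omega>" and "\<Omega> \<noteq> {}"
    and "h \<in> sobolev_W12 \<Omega>"
    and "AE z in lebesgue. z \<in> \<Omega> \<longrightarrow> hopf_product \<Omega> h z = 0"
  shows "\<forall>\<xi>. self_diffeomorphism \<Omega> \<xi> \<and> (\<forall>z\<in>\<Omega>. wirtinger_jacobian \<xi> z > 0)
           \<longrightarrow> dirichlet_energy \<Omega> h \<le> dirichlet_energy \<Omega> (\<lambda>z. h (\<xi> z))"
proof (intro allI impI, elim conjE)
  fix \<xi> assume \<xi>: "self_diffeomorphism \<Omega> \<xi>" and J: "\<forall>z\<in>\<Omega>. wirtinger_jacobian \<xi> z > 0"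
  have bij: "bij_betw \<xi> \<Omega> \<Omega>"
    using \<xi> by (simp add: self_diffeomorphism_def)
  have "smooth_diffeo_pair \<Omega> \<xi> (inv_into \<Omega> \<xi>)"
  proof (rule smooth_diffeo_pair.intro)
    show "smooth_on \<Omega> \<xi>" "smooth_on \<Omega> (inv_into \<Omega> \<xi>)"
      using \<xi> by (auto simp: self_diffeomorphism_def)
    fix z assume "z \<in> \<Omega>"
    then show "\<xi> z \<in> \<Omega>" "inv_into \<Omega> \<xi> z \<in> \<Omega>" "inv_into \<Omega> \<xi> (\<xi> z) = z" "\<xi> (inv_into \<Omega> \<xi> z) = z"
      using bij by (auto intro: bij_betw_apply bij_betw_inv_into[THEN bij_betw_apply]
          bij_betw_inv_into_left bij_betw_inv_into_right)
    show "cdet (frechet_derivative \<xi> (at z)) > 0"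
      using J \<open>z \<in> \<Omega>\<close> by (simp add: wirtinger_jacobian_eq_cdet)
  qed (fact assms(1))
  then show "dirichlet_energy \<Omega> h \<le> dirichlet_energy \<Omega> (\<lambda>z. h (\<xi> z))"
    using assms(4,5) by (rule smooth_diffeo_pair.dirichlet_energy_compose_ge)
qed

end
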